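(* Let $L$ be a Latin array of order $n$. If $L$ has at least $(2-\sqrt2)n^2$ distinct symbols, then $L$ has a transversal.
   Context: An array of order $n$ is an $n\times n$ array with a symbol in each cell; an entry is a triple $(i,j,A_{ij})$. An array is Latin if no symbol appears more than once in any row or column. A transversal of an $n\times n$ array is a set of $n$ entries, no two agreeing in row, column, or symbol. *)

theory Defs
  imports Complex_Main
begin

text \<open>An array of order n: a function L on row/column indices, only the values
  L i j for i, j < n matter (rows and columns indexed by {0..<n}).\<close>

definition entries :: "nat \<Rightarrow> (nat \<Rightarrow> nat \<Rightarrow> 'a) \<Rightarrow> (nat \<times> nat \<times> 'a) set" where
  "entries n L = {(i, j, L i j) | i j. i < n \<and> j < n}"

definition symbols :: "nat \<Rightarrow> (nat \<Rightarrow> nat \<Rightarrow> 'a) \<Rightarrow> 'a set" where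
  "symbols n L = {L i j | i j. i < n \<and> j < n}"

definition latin_array :: "nat \<Rightarrow> (nat \<Rightarrow> nat \<Rightarrow> 'a) \<Rightarrow> bool" where
  "latin_array n L \<longleftrightarrow>
     (\<forall>i<n. \<forall>j<n. \<forall>j'<n. j \<noteq> j' \<longrightarrow> L i j \<noteq> L i j') \<and>
     (\<forall>j<n. \<forall>i<n. \<forall>i'<n. i \<noteq> i' \<longrightarrow> L i j \<noteq> L i' j)"

definition transversal :: "nat \<Rightarrow> (nat \<Rightarrow> nat \<Rightarrow> 'a) \<Rightarrow> (nat \<times> nat \<times> 'a) set \<Rightarrow> bool" where
  "transversal n L T \<longleftrightarrow> T \<subseteq> entries n L \<and> card T = n \<and>
     (\<forall>(i, j, s)\<in>T. \<forall>(i', j', s')\<in>T. (i, j, s) \<noteq> (i', j', s') \<longrightarrow>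
        i \<noteq> i' \<and> j \<noteq> j' \<and> s \<noteq> s')"

definition has_transversal :: "nat \<Rightarrow> (nat \<Rightarrow> nat \<Rightarrow> 'a) \<Rightarrow> bool" where
  "has_transversal n L \<longleftrightarrow> (\<exists>T. transversal n L T)"

end

(*
  Proof idea. Deleting a suitable row and column keeps the symbol density, so by induction there is
  a partial transversal missing one row and one column; permute columns so that it lies on the
  diagonal. Choose one cell for each symbol that is neither on the diagonal nor in the missing row
  and column (the cross), and view these cells as arcs of a digraph G. A closed walk through the
  missing index whose cells carry distinct symbols, each off the diagonal or freed by the walk,
  yields a transversal.

  Since there are many symbols, the pairs joined by arcs of G in both directions outnumber the
  non-adjacent pairs by about (3 - 2 sqrt 2) n^2 / 2; let w be the number of vertices in the former. If the partial transversal is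
  chosen to have as few of its symbols as possible in the cross, then the diagonal symbols of these
  w vertices do not occur in the cross, so the sets A and B of positions of new symbols in the
  missing row and column have more than w elements each. Looking at the column of a vertex of B
  from which most of B can be reached, one finds almost w further vertices outside A and B. Hence
  3 w is at most about n, up to losses that are paid for by non-adjacent pairs, which contradicts
  w >= (sqrt 2 - 1) n.
*)
theory Submission
  imports Defs "HOL-Combinatorics.Cycles"
begin

section \<open>Digraphs and cyclic permutations\<close>

text \<open>Ordered pairs, so each unordered pair counts twice, just as opposite arcs do in the
  later comparison.\<close>

definition nonadjacent :: "('v \<times> 'v) set \<Rightarrow> 'v set \<Rightarrow> ('v \<times> 'v) set" where
  "nonadjacent G B = {(u, v) \<in> B \<times> B. u \<noteq> v \<and> (u, v) \<notin> G \<and> (v, u) \<notin> G}"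

abbreviation reach_in :: "('v \<times> 'v) set \<Rightarrow> 'v set \<Rightarrow> 'v \<Rightarrow> 'v set" where
  "reach_in G B p \<equiv> (G \<inter> B \<times> B)\<^sup>* `` {p}"

lemma reach_in_subset: "p \<in> B \<Longrightarrow> reach_in G B p \<subseteq> B"
  by (auto elim: rtranclE)

lemma finite_nonadjacent: "finite B \<Longrightarrow> finite (nonadjacent G B)"
  unfolding nonadjacent_def by (rule finite_subset[of _ "B \<times> B"]) auto

text \<open>A vertex with a largest reachable set is not adjacent to any vertex outside that set;
  remove it and repeat.\<close>

lemma nonadjacent_ge:
  assumes "finite B" and "d \<le> card B"
    and "\<And>p. p \<in> B \<Longrightarrow> card (reach_in G B p) + d \<le> card B"
  shows "d * (d + 1) \<le> card (nonadjacent G B)"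
  using assms
proof (induction d arbitrary: B)
  case 0
  then show ?case by simp
next
  case (Suc d)
  define R where "R = reach_in G B"
  have R_sub: "R q \<subseteq> B" if "q \<in> B" for q
    using reach_in_subset[OF that] by (simp add: R_def)
  have fin_R: "finite (R q)" if "q \<in> B" for q
    using R_sub[OF that] Suc.prems(1) finite_subset by blast
  have "B \<noteq> {}" using Suc.prems by auto
  then have "Max ((\<lambda>q. card (R q)) ` B) \<in> (\<lambda>q. card (R q)) ` B"
    using Suc.prems(1) by (intro Max_in) auto
  then obtain p where p: "p \<in> B" and "Max ((\<lambda>q. card (R q)) ` B) = card (R p)" by blast
  then have p_max: "card (R q) \<le> card (R p)" if "q \<in> B" for q
    using that Suc.prems(1) by (metis Max_ge finite_imageI imageI)
  define X where "X = B - R p"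
  have p_R: "p \<in> R p" by (simp add: R_def)
  have card_X: "Suc d \<le> card X"
    using Suc.prems(3)[OF p] R_sub[OF p] Suc.prems(1) fin_R[OF p]
    by (simp add: X_def card_Diff_subset R_def)
  have no_arc: "(p, x) \<notin> G \<and> (x, p) \<notin> G" if x: "x \<in> X" for x
  proof (intro conjI notI)
    assume "(p, x) \<in> G"
    then have "x \<in> R p" using x p by (auto simp: R_def X_def)
    then show False using x by (simp add: X_def)
  next
    assume "(x, p) \<in> G"
    then have "(x, p) \<in> G \<inter> B \<times> B" using x p by (auto simp: X_def)
    then have "insert x (R p) \<subseteq> R x"
      by (auto simp: R_def intro: converse_rtrancl_into_rtrancl)
    moreover have "x \<notin> R p" "x \<in> B" using x by (auto simp: X_def)
    ultimately have "card (R p) < card (R x)"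
      using fin_R[OF \<open>x \<in> B\<close>] fin_R[OF p] by (metis card_insert_disjoint card_mono lessI less_le_trans)
    then show False using p_max[OF \<open>x \<in> B\<close>] by simp
  qed
  define B1 where "B1 = B - {p}"
  have fin1: "finite B1" using Suc.prems(1) by (simp add: B1_def)
  have card1: "card B = Suc (card B1)"
    unfolding B1_def using card_Suc_Diff1[OF Suc.prems(1) p] by presburger
  have IH: "d * (d + 1) \<le> card (nonadjacent G B1)"
  proof (rule Suc.IH[OF fin1])
    show "d \<le> card B1" using Suc.prems(2) card1 by simp
    fix q assume q: "q \<in> B1"
    then have "q \<in> B" by (simp add: B1_def)
    have "reach_in G B1 q \<subseteq> R q"
      unfolding R_def using rtrancl_mono[of "G \<inter> B1 \<times> B1" "G \<inter> B \<times> B"] by (auto simp: B1_def)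
    then have "card (reach_in G B1 q) \<le> card (R q)" using fin_R[OF \<open>q \<in> B\<close>] card_mono by blast
    then show "card (reach_in G B1 q) + d \<le> card B1"
      using Suc.prems(3)[OF \<open>q \<in> B\<close>] card1 by (simp add: R_def)
  qed
  have "p \<notin> X" using p_R by (simp add: X_def)
  \<comment> \<open>Both orders of the pairs between \<open>p\<close> and \<open>X\<close> count,
    which adds at least \<open>2 * (d + 1)\<close> to \<open>d * (d + 1)\<close>.\<close>
  have "{p} \<times> X \<union> X \<times> {p} \<union> nonadjacent G B1 \<subseteq> nonadjacent G B"
    using no_arc p \<open>p \<notin> X\<close> by (auto simp: nonadjacent_def B1_def X_def)
  then have "card ({p} \<times> X \<union> X \<times> {p} \<union> nonadjacent G B1) \<le> card (nonadjacent G B)"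
    using finite_nonadjacent[OF Suc.prems(1)] card_mono by blast
  moreover have "card ({p} \<times> X \<union> X \<times> {p} \<union> nonadjacent G B1)
      = card X + card X + card (nonadjacent G B1)"
  proof -
    have fX: "finite X" using Suc.prems(1) by (simp add: X_def)
    have "card ({p} \<times> X \<union> X \<times> {p}) = card ({p} \<times> X) + card (X \<times> {p})"
      using \<open>p \<notin> X\<close> fX by (intro card_Un_disjoint) auto
    moreover have "card ({p} \<times> X \<union> X \<times> {p} \<union> nonadjacent G B1)
        = card ({p} \<times> X \<union> X \<times> {p}) + card (nonadjacent G B1)"
      using fX finite_nonadjacent[OF fin1]
      by (intro card_Un_disjoint) (auto simp: nonadjacent_def B1_def)
    ultimately show ?thesis by (simp add: card_cartesian_product)
  qed
  ultimately show ?case using IH card_X by simp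
qed

section \<open>Simple paths and closed walks\<close>

lemma distinct_path:
  assumes "(x, y) \<in> (G \<inter> B \<times> B)\<^sup>*" "x \<in> B"
  obtains ys where "ys \<noteq> []" "hd ys = x" "last ys = y" "distinct ys" "set ys \<subseteq> B"
    "successively (\<lambda>u v. (u, v) \<in> G) ys"
proof -
  have "\<exists>ys. ys \<noteq> [] \<and> hd ys = x \<and> last ys = y \<and> distinct ys \<and> set ys \<subseteq> B
      \<and> successively (\<lambda>u v. (u, v) \<in> G) ys"
    using assms(1)
  proof (induction rule: rtrancl_induct)
    case base
    show ?case using assms(2) by (intro exI[of _ "[x]"]) auto
  next
    case (step y z)
    then obtain ys where ys: "ys \<noteq> []" "hd ys = x" "last ys = y" "distinct ys" "set ys \<subseteq> B"
      "successively (\<lambda>u v. (u, v) \<in> G) ys" by blast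
    show ?case
    proof (cases "z \<in> set ys")
      case True
      then obtain us vs where *: "ys = us @ z # vs" by (meson split_list)
      then show ?thesis using ys
        by (intro exI[of _ "us @ [z]"]) (auto simp: successively_append_iff hd_append split: if_splits)
    next
      case False
      then show ?thesis using ys step.hyps(2)
        by (intro exI[of _ "ys @ [z]"]) (auto simp: successively_append_iff)
    qed
  qed
  then show ?thesis using that by blast
qed

definition arc_syms :: "('v \<Rightarrow> 'v \<Rightarrow> 's) \<Rightarrow> 'v list \<Rightarrow> 's list" where
  "arc_syms M zs = map (\<lambda>(x, y). M x y) (zip zs (tl zs))"

lemma arc_syms_simps [simp]:
  "arc_syms M [] = []" "arc_syms M [x] = []"
  "arc_syms M (x # y # zs) = M x y # arc_syms M (y # zs)"
  by (simp_all add: arc_syms_def)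

lemma arc_syms_append:
  "arc_syms M (xs @ y # ys) = arc_syms M (xs @ [y]) @ arc_syms M (y # ys)"
proof (induction xs)
  case (Cons x xs)
  then show ?case by (cases xs) auto
qed simp

lemma arc_syms_last: "ys \<noteq> [] \<Longrightarrow> arc_syms M (ys @ [z]) = arc_syms M ys @ [M (last ys) z]"
  by (induction ys rule: induct_list012) auto

lemma arc_syms_Cons: "ys \<noteq> [] \<Longrightarrow> arc_syms M (x # ys) = M x (hd ys) # arc_syms M ys"
  by (cases ys) auto

text \<open>Link between walks and transversals: the cells selected by the cyclic permutation are
  those of the closed walk, the closing step back to \<open>x\<close> included.\<close>

lemma cycle_permutation:
  assumes "distinct (x # xs)"
  obtains p where "p permutes set (x # xs)" "map (\<lambda>i. M i (p i)) (x # xs) = arc_syms M (x # xs @ [x])"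
proof
  let ?p = "cycle_of_list (x # xs)"
  show "?p permutes set (x # xs)" by (rule cycle_permutes)
  have rot: "map ?p (x # xs) = xs @ [x]"
    using cyclic_rotation[OF assms, of 1] by simp
  have "map (\<lambda>i. M i (?p i)) (x # xs) = map (\<lambda>(a, b). M a b) (zip (x # xs) (map ?p (x # xs)))"
    by (simp add: zip_map2 zip_same_conv_map del: zip_Cons_Cons list.map)
  also have "\<dots> = arc_syms M (x # xs @ [x])"
    unfolding rot arc_syms_def by (simp add: zip_append1 flip: append_Cons)
  finally show "map (\<lambda>i. M i (?p i)) (x # xs) = arc_syms M (x # xs @ [x])" .
qed

section \<open>Partial transversals missing one row and one column\<close>

text \<open>The partial transversal is the diagonal on \<open>V\<close>, missing row \<open>r\<close> and column \<open>r\<close>. The relation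
  \<open>G\<close> selects one cell for each symbol occurring neither on the diagonal nor in the cross of \<open>r\<close>.
  The assumptions \<open>swap_row\<close> and \<open>swap_col\<close> express that the partial transversal leaves as many
  cells of the cross as possible with symbols off the diagonal: otherwise exchanging the diagonal
  cells of \<open>k\<close> and \<open>l\<close> for \<open>(k, l)\<close> and \<open>(l, k)\<close> would improve it.\<close>

locale near_transversal =
  fixes V :: "'v set" and r :: 'v and M :: "'v \<Rightarrow> 'v \<Rightarrow> 's" and G :: "('v \<times> 'v) set"
  assumes finite_V: "finite V" and r_notin: "r \<notin> V"
    and row: "\<lbrakk>i \<in> insert r V; j \<in> insert r V; j' \<in> insert r V; M i j = M i j'\<rbrakk> \<Longrightarrow> j = j'"
    and col: "\<lbrakk>i \<in> insert r V; i' \<in> insert r V; j \<in> insert r V; M i j = M i' j\<rbrakk> \<Longrightarrow> i = i'"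
    and diag: "inj_on (\<lambda>v. M v v) V"
    and no_transversal: "p permutes insert r V \<Longrightarrow> \<not> inj_on (\<lambda>i. M i (p i)) (insert r V)"
    and arcs: "G \<subseteq> V \<times> V"
    and arc_new: "\<lbrakk>(k, l) \<in> G; v \<in> V\<rbrakk> \<Longrightarrow> M k l \<noteq> M v v"
    and arc_not_row: "\<lbrakk>(k, l) \<in> G; v \<in> insert r V\<rbrakk> \<Longrightarrow> M k l \<noteq> M r v"
    and arc_not_col: "\<lbrakk>(k, l) \<in> G; v \<in> insert r V\<rbrakk> \<Longrightarrow> M k l \<noteq> M v r"
    and arc_inj: "\<lbrakk>(k, l) \<in> G; (k', l') \<in> G; M k l = M k' l'\<rbrakk> \<Longrightarrow> k = k' \<and> l = l'"
    and swap_row: "\<lbrakk>(k, l) \<in> G; (l, k) \<in> G; v \<in> insert r V\<rbrakk> \<Longrightarrow> M k k \<noteq> M r v"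
    and swap_col: "\<lbrakk>(k, l) \<in> G; (l, k) \<in> G; v \<in> insert r V\<rbrakk> \<Longrightarrow> M k k \<noteq> M v r"
begin

definition D :: "'s set" where "D = (\<lambda>v. M v v) ` V"
text \<open>\<open>A\<close> and \<open>B\<close> hold the possible first and last vertices of a
  closed walk through \<open>r\<close> that uses new symbols of the cross.\<close>

definition A :: "'v set" where "A = {v \<in> V. M r v \<notin> D}"
definition B :: "'v set" where "B = {v \<in> V. M v r \<notin> D}"

lemma A_sub: "A \<subseteq> V" and B_sub: "B \<subseteq> V"
  by (auto simp: A_def B_def)

lemma finite_A: "finite A" and finite_B: "finite B"
  using finite_subset[OF A_sub finite_V] finite_subset[OF B_sub finite_V] by auto

text \<open>Duality: exchanging rows and columns reverses the arcs and interchanges \<open>A\<close>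
  and \<open>B\<close>, so results about one side carry over to the other.\<close>

lemma transposed: "near_transversal V r (\<lambda>i j. M j i) (G\<inverse>)"
proof
  fix p assume p: "p permutes insert r V"
  let ?q = "inv p"
  have q: "?q permutes insert r V" using p by (rule permutes_inv)
  show "\<not> inj_on (\<lambda>i. M (p i) i) (insert r V)"
  proof
    assume inj: "inj_on (\<lambda>i. M (p i) i) (insert r V)"
    have "inj_on (\<lambda>i. M i (?q i)) (insert r V)"
    proof (rule inj_onI)
      fix x y assume xy: "x \<in> insert r V" "y \<in> insert r V" "M x (?q x) = M y (?q y)"
      have "M (p (?q x)) (?q x) = M (p (?q y)) (?q y)"
        using xy(3) by (simp add: permutes_inverses[OF p])
      moreover have "?q x \<in> insert r V" "?q y \<in> insert r V"
        using xy(1,2) permutes_in_image[OF q] by auto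
      ultimately have "?q x = ?q y" using inj by (meson inj_onD)
      then show "x = y" by (metis permutes_inverses(1)[OF p])
    qed
    then show False using no_transversal[OF q] by simp
  qed
next
  show "finite V" "r \<notin> V" "inj_on (\<lambda>v. M v v) V" using finite_V r_notin diag by auto
  show "G\<inverse> \<subseteq> V \<times> V" using arcs by auto
next
  fix k l v assume "(k, l) \<in> G\<inverse>" and v: "v \<in> insert r V"
  then have "(l, k) \<in> G" by simp
  then show "M l k \<noteq> M v r" "M l k \<noteq> M r v" using v arc_not_col arc_not_row by auto
next
  fix k l v assume "(k, l) \<in> G\<inverse>" "(l, k) \<in> G\<inverse>" and v: "v \<in> insert r V"
  then have "(k, l) \<in> G" "(l, k) \<in> G" by auto
  then show "M k k \<noteq> M v r" "M k k \<noteq> M r v" using v swap_row swap_col by auto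
next
  fix k l v assume "(k, l) \<in> G\<inverse>" "v \<in> V"
  then show "M l k \<noteq> M v v" using arc_new by auto
next
  fix k l k' l' assume "(k, l) \<in> G\<inverse>" "(k', l') \<in> G\<inverse>" "M l k = M l' k'"
  then show "k = k' \<and> l = l'" using arc_inj[of l k l' k'] by auto
next
  fix i j j' assume "i \<in> insert r V" "j \<in> insert r V" "j' \<in> insert r V" "M j i = M j' i"
  then show "j = j'" using col by blast
next
  fix i i' j assume "i \<in> insert r V" "i' \<in> insert r V" "j \<in> insert r V" "M j i = M j i'"
  then show "i = i'" using row by blast
qed

text \<open>Outside \<open>E\<close> the permutation keeps the diagonal, whose symbols are distinct.
  The diagonal symbols of \<open>E\<close> are freed and may be reused.\<close>

lemma no_permutation:
  assumes p: "p permutes insert r V" and "E \<subseteq> insert r V" "r \<in> E"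
    and fix_p: "\<And>i. i \<in> V - E \<Longrightarrow> p i = i"
    and inj: "inj_on (\<lambda>i. M i (p i)) E"
    and free: "\<And>i v. \<lbrakk>i \<in> E; v \<in> V - E\<rbrakk> \<Longrightarrow> M i (p i) \<noteq> M v v"
  shows False
proof -
  have "inj_on (\<lambda>i. M i (p i)) (insert r V)"
  proof (rule inj_onI)
    fix x y assume x: "x \<in> insert r V" and y: "y \<in> insert r V" and eq: "M x (p x) = M y (p y)"
    consider "x \<in> E" "y \<in> E" | "x \<in> E" "y \<in> V - E" | "x \<in> V - E" "y \<in> E"
      | "x \<in> V - E" "y \<in> V - E" using x y \<open>r \<in> E\<close> by blast
    then show "x = y"
    proof cases
      case 1
      then show ?thesis using inj_onD[OF inj eq] by blast
    next
      case 2
      then show ?thesis using free[OF 2] fix_p[OF 2(2)] eq by metis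
    next
      case 3
      then show ?thesis using free[OF 3(2,1)] fix_p[OF 3(1)] eq by metis
    next
      case 4
      have "M x x = M y y" using eq unfolding fix_p[OF 4(1)] fix_p[OF 4(2)] .
      then show ?thesis using inj_onD[OF diag] 4 by blast
    qed
  qed
  then show False using no_transversal[OF p] by simp
qed

lemma no_cycle:
  assumes "distinct xs" "set xs \<subseteq> V"
    and syms: "distinct (arc_syms M (r # xs @ [r]))"
    and free: "\<And>v. v \<in> V - set xs \<Longrightarrow> M v v \<notin> set (arc_syms M (r # xs @ [r]))"
  shows False
proof -
  have "distinct (r # xs)" using assms r_notin by auto
  then obtain p where p: "p permutes set (r # xs)"
    and p_syms: "map (\<lambda>i. M i (p i)) (r # xs) = arc_syms M (r # xs @ [r])"
    by (rule cycle_permutation[where M = M])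
  have "p permutes insert r V" using permutes_subset[OF p, of "insert r V"] assms(2) by auto
  then show False
  proof (rule no_permutation[where E = "set (r # xs)"])
    show "set (r # xs) \<subseteq> insert r V" using assms(2) by auto
    show "inj_on (\<lambda>i. M i (p i)) (set (r # xs))"
      using syms unfolding p_syms[symmetric] distinct_map by blast
    fix i v assume "i \<in> set (r # xs)" "v \<in> V - set (r # xs)"
    then have "M i (p i) \<in> set (arc_syms M (r # xs @ [r]))" "v \<in> V - set xs"
      unfolding p_syms[symmetric] by auto
    then show "M i (p i) \<noteq> M v v" using free[of v] by auto
  qed (use permutes_not_in[OF p] in auto)
qed

text \<open>A transposition disjoint from the cycle frees \<open>M k k\<close> and
  \<open>M l l\<close> as well, at the price of using the symbols of \<open>(k, l)\<close> and
  \<open>(l, k)\<close>.\<close>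

lemma no_cycle_swap:
  assumes "distinct xs" "set xs \<subseteq> V" "k \<in> V - set xs" "l \<in> V - set xs" "k \<noteq> l"
    and syms: "distinct (M k l # M l k # arc_syms M (r # xs @ [r]))"
    and free: "\<And>v. v \<in> V - set xs - {k, l} \<Longrightarrow> M v v \<notin> set (M k l # M l k # arc_syms M (r # xs @ [r]))"
  shows False
proof -
  have "distinct (r # xs)" using assms r_notin by auto
  then obtain p where p: "p permutes set (r # xs)"
    and p_syms: "map (\<lambda>i. M i (p i)) (r # xs) = arc_syms M (r # xs @ [r])"
    by (rule cycle_permutation[where M = M])
  let ?q = "p \<circ> transpose k l"
  have kl: "k \<notin> set (r # xs)" "l \<notin> set (r # xs)" using assms r_notin by auto
  have q_out: "?q i = p i" if "i \<in> set (r # xs)" for i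
    using that kl by (auto simp: transpose_def)
  have q_kl: "?q k = l" "?q l = k" using permutes_not_in[OF p] kl by auto
  let ?E = "set (k # l # r # xs)"
  have q_syms: "map (\<lambda>i. M i (?q i)) (k # l # r # xs) = M k l # M l k # arc_syms M (r # xs @ [r])"
    unfolding p_syms[symmetric] list.map q_kl using q_out by simp
  have "p permutes insert r V" using permutes_subset[OF p, of "insert r V"] assms(2) by auto
  then have "?q permutes insert r V"
    using assms(3,4) by (intro permutes_compose permutes_swap_id) auto
  then show False
  proof (rule no_permutation[where E = ?E])
    show "?E \<subseteq> insert r V" using assms(2-4) by auto
    show "inj_on (\<lambda>i. M i (?q i)) ?E"
      using syms unfolding q_syms[symmetric] distinct_map by blast
    fix i v assume i: "i \<in> ?E" "v \<in> V - ?E"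
    then have "M i (?q i) \<in> set (map (\<lambda>i. M i (?q i)) (k # l # r # xs))" unfolding set_map by blast
    then have "M i (?q i) \<in> set (M k l # M l k # arc_syms M (r # xs @ [r]))"
      unfolding q_syms .
    moreover have "v \<in> V - set xs - {k, l}" using i by auto
    ultimately show "M i (?q i) \<noteq> M v v" using free[of v] by (metis (no_types, lifting))
  next
    fix i assume "i \<in> V - ?E"
    then show "?q i = i" using permutes_not_in[OF p, of i] by (auto simp: transpose_def)
  qed auto
qed

lemma diag_notin: "\<lbrakk>v \<in> V - X; X \<subseteq> V; x \<in> X\<rbrakk> \<Longrightarrow> M v v \<noteq> M x x"
  using diag by (auto dest: inj_onD)

lemma in_D: "v \<in> V \<Longrightarrow> M v v \<in> D"
  by (simp add: D_def)

lemma arc_notin_D: "(k, l) \<in> G \<Longrightarrow> M k l \<notin> D"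
  using arc_new by (auto simp: D_def)

lemma arc_V: "(k, l) \<in> G \<Longrightarrow> k \<in> V \<and> l \<in> V \<and> k \<noteq> l"
  using arcs arc_new by blast

text \<open>The empty walk: a new symbol at \<open>(r, r)\<close> would complete the
  diagonal.\<close>

lemma root_old: "M r r \<in> D"
proof (rule ccontr)
  assume "M r r \<notin> D"
  then have "M v v \<noteq> M r r" if "v \<in> V" for v using that by (metis D_def imageI)
  then show False using no_cycle[of "[]"] by simp
qed

lemma path_syms:
  assumes "successively (\<lambda>u v. (u, v) \<in> G) ys" "distinct ys"
  shows "distinct (arc_syms M ys)"
    and "set (arc_syms M ys) \<subseteq> {M k l | k l. (k, l) \<in> G \<and> k \<in> set ys \<and> l \<in> set ys}"
proof -
  have "distinct (arc_syms M ys) \<and> set (arc_syms M ys) \<subseteq> {M k l | k l. (k, l) \<in> G \<and> k \<in> set ys \<and> l \<in> set ys}"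
    using assms
  proof (induction ys rule: induct_list012)
    case (3 x y zs)
    have IH: "distinct (arc_syms M (y # zs))"
      "set (arc_syms M (y # zs)) \<subseteq> {M k l |k l. (k, l) \<in> G \<and> k \<in> set (y # zs) \<and> l \<in> set (y # zs)}"
      using "3.IH"(2) "3.prems" by auto
    have xy: "(x, y) \<in> G" "x \<notin> set (y # zs)" using "3.prems" by auto
    have "M x y \<notin> set (arc_syms M (y # zs))"
      using IH(2) xy arc_inj by blast
    moreover have "set (arc_syms M (y # zs))
        \<subseteq> {M k l |k l. (k, l) \<in> G \<and> k \<in> set (x # y # zs) \<and> l \<in> set (x # y # zs)}"
      using IH(2) by fastforce
    moreover have "M x y \<in> {M k l |k l. (k, l) \<in> G \<and> k \<in> set (x # y # zs) \<and> l \<in> set (x # y # zs)}"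
      using xy by auto
    ultimately show ?case using IH(1) by simp
  qed auto
  then show "distinct (arc_syms M ys)"
    and "set (arc_syms M ys) \<subseteq> {M k l | k l. (k, l) \<in> G \<and> k \<in> set ys \<and> l \<in> set ys}" by auto
qed

lemma arc_sym_props:
  assumes "s \<in> set (arc_syms M ys)" "successively (\<lambda>u v. (u, v) \<in> G) ys" "distinct ys"
  shows "s \<notin> D" "v \<in> insert r V \<Longrightarrow> s \<noteq> M r v" "v \<in> insert r V \<Longrightarrow> s \<noteq> M v r"
proof -
  obtain k l where "(k, l) \<in> G" "s = M k l" using path_syms(2)[OF assms(2,3)] assms(1) by blast
  then show "s \<notin> D" "v \<in> insert r V \<Longrightarrow> s \<noteq> M r v" "v \<in> insert r V \<Longrightarrow> s \<noteq> M v r"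
    using arc_notin_D arc_not_row arc_not_col by auto
qed

text \<open>The arc symbols on the cycle \<open>r\<close>, \<open>ys\<close>, \<open>r\<close> are
  new, distinct and absent from the cross, so only its first and last cells can clash.\<close>

lemma path_conflict_list:
  assumes ys: "ys \<noteq> []" "distinct ys" "set ys \<subseteq> V" "successively (\<lambda>u v. (u, v) \<in> G) ys"
    and ends: "hd ys \<in> A" "last ys \<in> B"
  shows "M r (hd ys) = M (last ys) r"
proof (rule ccontr)
  assume neq: "M r (hd ys) \<noteq> M (last ys) r"
  have eq: "arc_syms M (r # ys @ [r]) = M r (hd ys) # arc_syms M ys @ [M (last ys) r]"
    using ys(1) by (simp add: arc_syms_Cons arc_syms_last)
  have V: "hd ys \<in> V" "last ys \<in> V" using ends A_sub B_sub by auto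
  note props = arc_sym_props[OF _ ys(4,2)]
  show False
  proof (rule no_cycle[OF ys(2,3)])
    show "distinct (arc_syms M (r # ys @ [r]))"
      unfolding eq using neq path_syms(1)[OF ys(4,2)] props(2)[of _ "hd ys"] props(3)[of _ "last ys"] V by auto
    fix v assume "v \<in> V - set ys"
    then have "M v v \<in> D" by (simp add: in_D)
    then show "M v v \<notin> set (arc_syms M (r # ys @ [r]))"
      unfolding eq using ends props(1) by (auto simp: A_def B_def)
  qed
qed

text \<open>Since row \<open>r\<close> repeats no symbol, this means that a vertex of
  \<open>B\<close> can be reached from at most one vertex of \<open>A\<close>.\<close>

lemma path_conflict:
  assumes "a \<in> A" "b \<in> B" "(a, b) \<in> G\<^sup>*"
  shows "M r a = M b r"
proof -
  have "G \<inter> V \<times> V = G" using arcs by auto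
  then have "(a, b) \<in> (G \<inter> V \<times> V)\<^sup>*" "a \<in> V" using assms A_sub by auto
  then obtain ys where "ys \<noteq> []" "hd ys = a" "last ys = b" "distinct ys" "set ys \<subseteq> V"
    "successively (\<lambda>u v. (u, v) \<in> G) ys" by (rule distinct_path)
  then show ?thesis using path_conflict_list[of ys] assms by auto
qed

end

section \<open>Pairs of opposite arcs\<close>

context near_transversal
begin

definition H :: "('v \<times> 'v) set" where "H = G \<inter> G\<inverse>"
definition W :: "'v set" where "W = {v \<in> V. H `` {v} \<noteq> {}}"
text \<open>The hubs. An exchange along \<open>H\<close> will have to avoid two given vertices; with
  two partners this is possible unless the partners are exactly those two.\<close>

definition Wh :: "'v set" where "Wh = {v \<in> V. 2 \<le> card (H `` {v})}"

lemma H_sym: "(u, v) \<in> H \<Longrightarrow> (v, u) \<in> H"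
  by (auto simp: H_def)

lemma H_G: "(u, v) \<in> H \<Longrightarrow> (u, v) \<in> G \<and> (v, u) \<in> G"
  by (auto simp: H_def)

lemma H_V: "(u, v) \<in> H \<Longrightarrow> u \<in> V \<and> v \<in> V \<and> u \<noteq> v"
  using arc_V by (auto simp: H_def)

lemma finite_G: "finite G"
  using finite_subset[OF arcs] finite_V by simp

lemma finite_H: "finite H"
  using finite_G by (simp add: H_def)

lemma finite_H_image: "finite (H `` X)"
  using finite_subset[of "H `` X" V] H_V finite_V by blast

lemma Wh_W: "Wh \<subseteq> W" and W_V: "W \<subseteq> V"
  by (auto simp: Wh_def W_def)

lemma finite_W: "finite W" and finite_Wh: "finite Wh"
  using finite_subset[OF W_V finite_V] finite_subset[OF Wh_W] by auto

lemma H_W: "(u, v) \<in> H \<Longrightarrow> u \<in> W \<and> v \<in> W"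
  using H_V[of u v] H_sym[of u v] unfolding W_def by blast

text \<open>The pairs over \<open>V\<close> split into the diagonal, the non-adjacent pairs and
  \<open>G \<union> G\<inverse>\<close>, which has \<open>2 * card G - card H\<close> elements. Thus
  many arcs force many opposite pairs.\<close>

lemma card_H: "card H + card V * (card V - 1) = 2 * card G + card (nonadjacent G V)"
proof -
  let ?N = "nonadjacent G V" and ?I = "(\<lambda>v. (v, v)) ` V"
  have fin_N: "finite ?N" by (rule finite_nonadjacent[OF finite_V])
  have "V \<times> V = ((G \<union> G\<inverse>) \<union> ?N) \<union> ?I"
    using arc_V by (auto simp: nonadjacent_def)
  then have "card V * card V = card (((G \<union> G\<inverse>) \<union> ?N) \<union> ?I)"
    by (metis card_cartesian_product)
  also have "\<dots> = card ((G \<union> G\<inverse>) \<union> ?N) + card ?I"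
    using finite_G fin_N finite_V arc_V by (intro card_Un_disjoint) (auto simp: nonadjacent_def)
  also have "card ((G \<union> G\<inverse>) \<union> ?N) = card (G \<union> G\<inverse>) + card ?N"
    using finite_G fin_N by (intro card_Un_disjoint) (auto simp: nonadjacent_def)
  also have "card ?I = card V" by (simp add: card_image inj_on_def)
  finally have "card V * card V = card (G \<union> G\<inverse>) + card ?N + card V" .
  moreover have "card (G \<union> G\<inverse>) + card H = card G + card G"
    using card_Un_Int[of G "G\<inverse>"] finite_G by (simp add: H_def card_inverse)
  moreover have "card V * (card V - 1) + card V = card V * card V" by (cases "card V") auto
  ultimately show ?thesis by linarith
qed

lemma diag_W_row: "\<lbrakk>w \<in> W; v \<in> insert r V\<rbrakk> \<Longrightarrow> M w w \<noteq> M r v"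
  unfolding W_def using swap_row H_G by blast

text \<open>The cells of row \<open>r\<close> with old symbols carry distinct diagonal symbols, none
  of them from a vertex of \<open>W\<close>. The cell \<open>(r, r)\<close> is among them and
  accounts for the \<open>+ 1\<close>.\<close>

lemma card_A_ge: "card W + 1 \<le> card A"
proof -
  have "(\<lambda>v. M r v) ` insert r (V - A) \<subseteq> (\<lambda>v. M v v) ` (V - W)"
  proof (rule image_subsetI)
    fix v assume v: "v \<in> insert r (V - A)"
    then have "M r v \<in> D" using root_old by (auto simp: A_def)
    then obtain u where u: "u \<in> V" "M r v = M u u" by (auto simp: D_def)
    then have "u \<notin> W" using diag_W_row[of u v] v by auto
    then show "M r v \<in> (\<lambda>v. M v v) ` (V - W)" using u by auto
  qed
  then have "card ((\<lambda>v. M r v) ` insert r (V - A)) \<le> card ((\<lambda>v. M v v) ` (V - W))"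
    using finite_V by (intro card_mono) auto
  moreover have "card ((\<lambda>v. M r v) ` insert r (V - A)) = card (insert r (V - A))"
    by (intro card_image inj_onI) (use row in auto)
  moreover have "card ((\<lambda>v. M v v) ` (V - W)) \<le> card (V - W)"
    using finite_V by (intro card_image_le) auto
  moreover have "card (insert r (V - A)) = Suc (card V - card A)"
    using finite_V r_notin A_sub finite_A by (simp add: card_Diff_subset)
  moreover have "card (V - W) = card V - card W"
    using W_V finite_W by (simp add: card_Diff_subset)
  moreover have "card W \<le> card V" "card A \<le> card V"
    using W_V A_sub finite_V by (auto intro: card_mono)
  ultimately show ?thesis by linarith
qed

lemma transposed_eqs:
  "near_transversal.A V r (\<lambda>i j. M j i) = B" "near_transversal.B V r (\<lambda>i j. M j i) = A"
  "near_transversal.H (G\<inverse>) = H" "near_transversal.W V (G\<inverse>) = W" "near_transversal.Wh V (G\<inverse>) = Wh"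
  "nonadjacent (G\<inverse>) X = nonadjacent G X"
proof -
  interpret T: near_transversal V r "\<lambda>i j. M j i" "G\<inverse>" by (rule transposed)
  show H: "T.H = H" by (auto simp: T.H_def H_def)
  show "T.A = B" "T.B = A" by (auto simp: T.A_def T.B_def A_def B_def T.D_def D_def)
  show "T.W = W" "T.Wh = Wh" by (auto simp: T.W_def W_def T.Wh_def Wh_def H)
  show "nonadjacent (G\<inverse>) X = nonadjacent G X" by (auto simp: nonadjacent_def)
qed

lemma card_B_ge: "card W + 1 \<le> card B"
proof -
  interpret T: near_transversal V r "\<lambda>i j. M j i" "G\<inverse>" by (rule transposed)
  show ?thesis using T.card_A_ge by (simp add: transposed_eqs)
qed

lemma loop_conflict: "\<lbrakk>a \<in> A; a \<in> B\<rbrakk> \<Longrightarrow> M r a = M a r"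
  using path_conflict by blast

text \<open>An arc would give \<open>M r a = M b r\<close>, while \<open>b\<close> alone is a path
  with \<open>M r b = M b r\<close>; row \<open>r\<close> repeats no symbol.\<close>

lemma A_B_independent: "\<lbrakk>a \<in> A; b \<in> A; b \<in> B\<rbrakk> \<Longrightarrow> (a, b) \<notin> G"
proof
  assume *: "a \<in> A" "b \<in> A" "b \<in> B" "(a, b) \<in> G"
  then have "M r a = M b r" by (intro path_conflict) auto
  also have "\<dots> = M r b" using loop_conflict * by simp
  finally have "a = b" using row[of r a b] * A_sub by auto
  then show False using arc_V * by blast
qed

lemma card_AB_bound: "2 * card W + 2 \<le> card V + card (A \<inter> B)"
proof -
  have "card A + card B = card (A \<union> B) + card (A \<inter> B)"
    using card_Un_Int[OF finite_A finite_B] .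
  moreover have "card (A \<union> B) \<le> card V" using A_sub B_sub finite_V by (intro card_mono) auto
  ultimately show ?thesis using card_A_ge card_B_ge by linarith
qed

lemma independent_nonadjacent:
  assumes "X \<subseteq> V" "\<And>x y. \<lbrakk>x \<in> X; y \<in> X\<rbrakk> \<Longrightarrow> (x, y) \<notin> G"
  shows "card X * (card X - 1) = card (nonadjacent G X)"
proof -
  have "finite X" using finite_subset[OF assms(1) finite_V] .
  have eq: "X \<times> X = nonadjacent G X \<union> (\<lambda>x. (x, x)) ` X"
    using assms(2) by (auto simp: nonadjacent_def)
  have "card (X \<times> X) = card (nonadjacent G X) + card X"
    unfolding eq using \<open>finite X\<close> finite_nonadjacent[OF \<open>finite X\<close>]
    by (subst card_Un_disjoint) (auto simp: nonadjacent_def card_image inj_on_def)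
  then have "card X * card X = card (nonadjacent G X) + card X"
    by (simp add: card_cartesian_product)
  then show ?thesis by (cases "card X") auto
qed

lemma nonadjacent_mono: "X \<subseteq> Y \<Longrightarrow> nonadjacent G X \<subseteq> nonadjacent G Y"
  by (auto simp: nonadjacent_def)

lemma card_H_le_W: "card H \<le> card W * (card W - 1)"
proof -
  have "H \<subseteq> W \<times> W - (\<lambda>x. (x, x)) ` W" using H_W H_V by auto
  then have "card H \<le> card (W \<times> W - (\<lambda>x. (x, x)) ` W)"
    using finite_W by (intro card_mono) auto
  also have "\<dots> = card W * card W - card W"
    using finite_W by (subst card_Diff_subset) (auto simp: card_image inj_on_def card_cartesian_product)
  finally show ?thesis by (simp add: diff_mult_distrib2)
qed

lemma card_leaf_arcs: "card (H \<inter> (W - Wh) \<times> UNIV) \<le> card (W - Wh)"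
proof -
  have "inj_on fst (H \<inter> (W - Wh) \<times> UNIV)"
  proof (rule inj_onI)
    fix x y assume x: "x \<in> H \<inter> (W - Wh) \<times> UNIV" and y: "y \<in> H \<inter> (W - Wh) \<times> UNIV" and "fst x = fst y"
    then obtain u k l where *: "x = (u, k)" "y = (u, l)" by (metis prod.collapse)
    have "u \<in> W - Wh" using x * by auto
    then have "card (H `` {u}) \<le> 1" using W_V by (auto simp: Wh_def)
    moreover have "k \<in> H `` {u}" "l \<in> H `` {u}" using x y * by auto
    ultimately have "k = l" using finite_H_image by (metis One_nat_def card_le_Suc0_iff_eq)
    then show "x = y" using * by simp
  qed
  moreover have "fst ` (H \<inter> (W - Wh) \<times> UNIV) \<subseteq> W - Wh" by auto
  ultimately show ?thesis using finite_W card_inj_on_le by blast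
qed

lemma card_H_le_no_hub: "Wh = {} \<Longrightarrow> card H \<le> card W"
proof -
  assume "Wh = {}"
  then have "H \<inter> (W - Wh) \<times> UNIV = H" using H_W by auto
  then show ?thesis using card_leaf_arcs \<open>Wh = {}\<close> by simp
qed

text \<open>A pair in \<open>H\<close> lies within \<open>Wh\<close> or has an end with a single
  partner. Among the pairs from the \<open>B\<close> side to the \<open>A\<close> side,
  \<open>path_conflict\<close> allows only one for each start, which saves most of the
  product.\<close>

lemma card_H_le:
  "card H + card (Wh \<inter> (B - A)) * card (Wh \<inter> (A - B))
   \<le> card Wh * (card Wh - 1) + 2 * card (W - Wh) + card (Wh \<inter> (B - A))"
proof -
  let ?b = "Wh \<inter> (B - A)" and ?a = "Wh \<inter> (A - B)"
  define Q where "Q = ?b \<times> ?a"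
  define P where "P = Wh \<times> Wh - (\<lambda>x. (x, x)) ` Wh"
  have card_P: "card P = card Wh * (card Wh - 1)"
    unfolding P_def using finite_Wh
    by (subst card_Diff_subset) (auto simp: card_image inj_on_def card_cartesian_product diff_mult_distrib2)
  have fin: "finite P" "finite Q" "Q \<subseteq> P" using finite_Wh by (auto simp: P_def Q_def)
  have card_Q: "card (H \<inter> Q) \<le> card ?b"
  proof -
    have "inj_on fst (H \<inter> Q)"
    proof (rule inj_onI)
      fix x y assume x: "x \<in> H \<inter> Q" and y: "y \<in> H \<inter> Q" and "fst x = fst y"
      then obtain u k l where *: "x = (u, k)" "y = (u, l)" by (metis prod.collapse)
      have kl: "u \<in> B" "k \<in> A" "l \<in> A" "(k, u) \<in> G" "(l, u) \<in> G"
        using x y * H_G by (auto simp: Q_def)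
      then have "M r k = M u r" "M r l = M u r" by (auto intro!: path_conflict)
      then have "k = l" using row[of r k l] kl A_sub by auto
      then show "x = y" using * by simp
    qed
    moreover have "fst ` (H \<inter> Q) \<subseteq> ?b" by (auto simp: Q_def)
    ultimately show ?thesis using finite_Wh by (meson card_inj_on_le finite_Int)
  qed
  have "H \<subseteq> (P - Q) \<union> (H \<inter> Q) \<union> (H \<inter> (W - Wh) \<times> UNIV) \<union> (H \<inter> (W - Wh) \<times> UNIV)\<inverse>"
    using H_W H_V H_sym by (auto simp: P_def)
  then have "card H \<le> card ((P - Q) \<union> (H \<inter> Q) \<union> (H \<inter> (W - Wh) \<times> UNIV) \<union> (H \<inter> (W - Wh) \<times> UNIV)\<inverse>)"
    using fin finite_H by (intro card_mono) auto
  also have "\<dots> \<le> card (P - Q) + card (H \<inter> Q) + card (H \<inter> (W - Wh) \<times> UNIV) + card ((H \<inter> (W - Wh) \<times> UNIV)\<inverse>)"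
    by (meson add_le_mono card_Un_le dual_order.refl le_trans)
  also have "\<dots> \<le> card (P - Q) + card ?b + card (W - Wh) + card (W - Wh)"
    using card_Q card_leaf_arcs by (simp add: card_inverse)
  finally have "card H \<le> card (P - Q) + card ?b + 2 * card (W - Wh)" by simp
  moreover have "card (P - Q) + card Q = card P"
    using fin by (metis card_Diff_subset card_mono le_add_diff_inverse2)
  moreover have "card Q = card ?b * card ?a" by (simp add: Q_def card_cartesian_product)
  ultimately show ?thesis using card_P by linarith
qed

end

section \<open>Closed walks with one cell that is not an arc\<close>

context near_transversal
begin

lemma arc_syms_disjoint:
  assumes "successively (\<lambda>u v. (u, v) \<in> G) us" "successively (\<lambda>u v. (u, v) \<in> G) ys"
    "distinct (us @ ys)"
  shows "set (arc_syms M us) \<inter> set (arc_syms M ys) = {}"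
proof (rule ccontr)
  assume "set (arc_syms M us) \<inter> set (arc_syms M ys) \<noteq> {}"
  then obtain s where s: "s \<in> set (arc_syms M us)" "s \<in> set (arc_syms M ys)" by blast
  have "distinct us" "distinct ys" using assms(3) by auto
  then obtain k l k' l' where "(k, l) \<in> G" "(k', l') \<in> G" "s = M k l" "s = M k' l'"
    and "k \<in> set us" "k' \<in> set ys"
    using path_syms(2)[OF assms(1)] path_syms(2)[OF assms(2)] s by blast
  then show False using arc_inj[of k l k' l'] assms(3) by auto
qed

text \<open>On the closed walk \<open>r\<close>, \<open>us\<close>, \<open>ys\<close>,
  \<open>r\<close> the cell \<open>(last us, hd ys)\<close> need not be an arc: it suffices that its
  symbol is freed by the walk, or is new and occurs nowhere else on it.\<close>

lemma no_linked_paths: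
  assumes us: "us \<noteq> []" "successively (\<lambda>u v. (u, v) \<in> G) us" "hd us \<in> A"
    and ys: "ys \<noteq> []" "successively (\<lambda>u v. (u, v) \<in> G) ys" "last ys \<in> B"
    and dist: "distinct (us @ ys)" and V: "set us \<subseteq> V" "set ys \<subseteq> V"
    and neq: "M r (hd us) \<noteq> M (last ys) r"
    and link: "M (last us) (hd ys) \<in> (\<lambda>v. M v v) ` (set us \<union> set ys)
      \<or> M (last us) (hd ys) \<notin> D \<and> M (last us) (hd ys) \<noteq> M r (hd us)
        \<and> M (last us) (hd ys) \<noteq> M (last ys) r
        \<and> M (last us) (hd ys) \<notin> set (arc_syms M us) \<union> set (arc_syms M ys)"
  shows False
proof -
  let ?c = "M (last us) (hd ys)"
  have d: "distinct us" "distinct ys" using dist by auto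
  have "arc_syms M (r # us @ ys @ [r]) = M r (hd us) # arc_syms M (us @ ys @ [r])"
    using us(1) by (simp add: arc_syms_Cons)
  also have "arc_syms M (us @ ys @ [r]) = arc_syms M (us @ [hd ys]) @ arc_syms M (ys @ [r])"
    using ys(1) arc_syms_append[of M us "hd ys" "tl ys @ [r]"] by (simp flip: append_Cons)
  also have "\<dots> = (arc_syms M us @ [?c]) @ (arc_syms M ys @ [M (last ys) r])"
    using us(1) ys(1) by (simp add: arc_syms_last)
  finally have eq: "arc_syms M (r # (us @ ys) @ [r])
      = M r (hd us) # arc_syms M us @ ?c # arc_syms M ys @ [M (last ys) r]" by simp
  have ends: "hd us \<in> insert r V" "last ys \<in> insert r V" using us(3) ys(3) A_sub B_sub by auto
  have new: "M r (hd us) \<notin> D" "M (last ys) r \<notin> D" using us(3) ys(3) by (auto simp: A_def B_def)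
  note pu = arc_sym_props[OF _ us(2) d(1)] and py = arc_sym_props[OF _ ys(2) d(2)]
  have c_D: "?c \<in> (\<lambda>v. M v v) ` (set us \<union> set ys) \<Longrightarrow> ?c \<in> D"
    using V by (auto simp: D_def)
  have c: "?c \<noteq> M r (hd us)" "?c \<noteq> M (last ys) r" "?c \<notin> set (arc_syms M us)" "?c \<notin> set (arc_syms M ys)"
    using link c_D new pu(1)[of ?c] py(1)[of ?c] by (metis UnCI)+
  have ends_new: "M r (hd us) \<notin> set (arc_syms M us)" "M (last ys) r \<notin> set (arc_syms M us)"
    "M r (hd us) \<notin> set (arc_syms M ys)" "M (last ys) r \<notin> set (arc_syms M ys)"
    using pu(2)[OF _ ends(1)] pu(3)[OF _ ends(2)] py(2)[OF _ ends(1)] py(3)[OF _ ends(2)] by blast+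
  show False
  proof (rule no_cycle[OF dist])
    show "set (us @ ys) \<subseteq> V" using V by simp
    show "distinct (arc_syms M (r # (us @ ys) @ [r]))"
      unfolding eq using c neq path_syms(1)[OF us(2) d(1)] path_syms(1)[OF ys(2) d(2)]
        arc_syms_disjoint[OF us(2) ys(2) dist] ends_new by auto
    fix v assume v: "v \<in> V - set (us @ ys)"
    then have vD: "M v v \<in> D" by (simp add: in_D)
    have "M v v \<noteq> ?c"
    proof
      assume e: "M v v = ?c"
      then have "?c \<in> (\<lambda>v. M v v) ` (set us \<union> set ys)" using link vD by auto
      then obtain x where "x \<in> set us \<union> set ys" "M v v = M x x" using e by auto
      then show False using diag_notin[of v "set (us @ ys)" x] v V by auto
    qed
    then show "M v v \<notin> set (arc_syms M (r # (us @ ys) @ [r]))"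
      unfolding eq using vD new pu(1)[of "M v v"] py(1)[of "M v v"] by auto
  qed
qed

text \<open>The first cell may carry an old symbol here, because the walk passes through
  \<open>b\<close> and thereby frees it.\<close>

lemma no_path_from_root:
  assumes ys: "ys \<noteq> []" "successively (\<lambda>u v. (u, v) \<in> G) ys" "last ys \<in> B"
    and "distinct ys" "set ys \<subseteq> V" "b \<in> set ys" "M r (hd ys) = M b b"
  shows False
proof -
  have eq: "arc_syms M (r # ys @ [r]) = M b b # arc_syms M ys @ [M (last ys) r]"
    using ys(1) assms(7) by (simp add: arc_syms_Cons arc_syms_last)
  have bD: "M b b \<in> D" using assms(5,6) by (auto simp: D_def)
  have new: "M (last ys) r \<notin> D" "last ys \<in> insert r V" using ys(3) by (auto simp: B_def)
  note props = arc_sym_props[OF _ ys(2) \<open>distinct ys\<close>]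
  show False
  proof (rule no_cycle[OF \<open>distinct ys\<close> \<open>set ys \<subseteq> V\<close>])
    show "distinct (arc_syms M (r # ys @ [r]))"
      unfolding eq using path_syms(1)[OF ys(2) \<open>distinct ys\<close>] bD new props(1)[of "M b b"]
        props(3)[OF _ new(2)] by auto
    fix v assume v: "v \<in> V - set ys"
    then have "M v v \<in> D" by (simp add: in_D)
    moreover have "M v v \<noteq> M b b" using diag_notin[of v "set ys" b] v assms by auto
    ultimately show "M v v \<notin> set (arc_syms M (r # ys @ [r]))"
      unfolding eq using new props(1)[of "M v v"] by auto
  qed
qed

text \<open>The walk \<open>r\<close>, \<open>a\<close>, \<open>p\<close>, \<open>r\<close> uses the
  symbol \<open>M k k\<close>, which the exchange of \<open>k\<close> and \<open>l\<close>
  frees.\<close>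

lemma no_swapped_link:
  assumes "a \<in> A" "p \<in> B" "a \<noteq> p" "M r a \<noteq> M p r" "(k, l) \<in> H"
    and "k \<notin> {a, p}" "l \<notin> {a, p}" "M a p = M k k"
  shows False
proof -
  have V: "a \<in> V" "p \<in> V" "k \<in> V" "l \<in> V" "k \<noteq> l" using assms A_sub B_sub H_V by auto
  have G: "(k, l) \<in> G" "(l, k) \<in> G" using assms(5) H_G by auto
  have kl: "M k l \<noteq> M l k" using arc_inj[OF G] V(5) by auto
  have new: "M r a \<notin> D" "M p r \<notin> D" "M k l \<notin> D" "M l k \<notin> D" "M k k \<in> D"
    using assms(1,2) arc_notin_D G V by (auto simp: A_def B_def D_def)
  show False
  proof (rule no_cycle_swap[of "[a, p]" k l])
    show "distinct (M k l # M l k # arc_syms M (r # [a, p] @ [r]))"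
      using kl new assms(4,8) arc_not_row[OF G(1), of a] arc_not_row[OF G(2), of a]
        arc_not_col[OF G(1), of p] arc_not_col[OF G(2), of p] V by auto
    fix v assume v: "v \<in> V - set [a, p] - {k, l}"
    then have "M v v \<in> D" by (simp add: in_D)
    moreover have "M v v \<noteq> M k k" using diag_notin[of v "{k}" k] v V by auto
    ultimately show "M v v \<notin> set (M k l # M l k # arc_syms M (r # [a, p] @ [r]))"
      using new assms(8) by auto
  qed (use assms V in auto)
qed

text \<open>A partner of \<open>w\<close> outside \<open>{a, p}\<close> allows an exchange that
  frees \<open>M w w\<close>. Otherwise the partners are \<open>a\<close> and \<open>p\<close>, and
  the path \<open>a\<close>, \<open>w\<close>, \<open>p\<close> contradicts
  \<open>path_conflict\<close>.\<close>

lemma no_hub_link: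
  assumes "a \<in> A" "p \<in> B" "a \<noteq> p" "M r a \<noteq> M p r" "w \<in> Wh"
  shows "M a p \<noteq> M w w"
proof
  assume eq: "M a p = M w w"
  have V: "a \<in> V" "p \<in> V" "w \<in> V" using assms A_sub B_sub by (auto simp: Wh_def)
  have w: "w \<noteq> a" "w \<noteq> p" using row[of a p a] col[of a p p] eq V assms(3) by auto
  show False
  proof (cases "H `` {w} \<subseteq> {a, p}")
    case True
    moreover have "2 \<le> card (H `` {w})" using assms(5) by (simp add: Wh_def)
    moreover have "card {a, p} = 2" using assms(3) by simp
    ultimately have "H `` {w} = {a, p}" by (metis card_seteq finite.emptyI finite_insert)
    then have "(w, a) \<in> H" "(w, p) \<in> H" by auto
    then have "(a, w) \<in> G" "(w, p) \<in> G" using H_G by auto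
    then have "(a, p) \<in> G\<^sup>*" by auto
    then show False using path_conflict assms by blast
  next
    case False
    then obtain l where "(w, l) \<in> H" "l \<notin> {a, p}" by blast
    then show False using no_swapped_link[OF assms(1-4), of w l] w eq by auto
  qed
qed

text \<open>The set \<open>K\<close> consists of the rows \<open>k\<close> whose entry in column \<open>p\<close> could continue a closed walk
  \<open>r \<rightarrow> \<dots> \<rightarrow> k \<rightarrow> p \<rightarrow> \<dots> \<rightarrow> r\<close>: its symbol is new, or is freed by a path from \<open>p\<close> in \<open>B - A\<close>, or
  is freed by an exchange along \<open>H\<close>. Such rows must essentially avoid both \<open>A\<close> and \<open>B\<close>.\<close>

lemma count_from_column:
  assumes "B - A \<noteq> {}"
  obtains m d where "m * (m - 1) + d * (d + 1) \<le> card (nonadjacent G V)"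
    "card (A \<inter> B) \<le> m"
    "2 * card W + card Wh + 1 \<le> card V + card (Wh \<inter> (B - A)) + d + m"
proof -
  define B' where "B' = B - A"
  have B'_V: "B' \<subseteq> V" and fin_B': "finite B'" using B_sub finite_B by (auto simp: B'_def)
  define R where "R = reach_in G B'"
  have "Max ((\<lambda>q. card (R q)) ` B') \<in> (\<lambda>q. card (R q)) ` B'"
    using fin_B' assms by (intro Max_in) (auto simp: B'_def)
  then obtain p where p: "p \<in> B'" and "Max ((\<lambda>q. card (R q)) ` B') = card (R p)" by blast
  then have p_max: "card (R q) \<le> card (R p)" if "q \<in> B'" for q
    using that fin_B' by (metis Max_ge finite_imageI imageI)
  have R_B': "R p \<subseteq> B'" using reach_in_subset[OF p] by (simp add: R_def)
  then have fin_R: "finite (R p)" using fin_B' finite_subset by blast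
  \<comment> \<open>The vertices of \<open>B'\<close> not reached from the best start
    \<open>p\<close>; \<open>nonadjacent_ge\<close> turns them into non-adjacent pairs.\<close>
  define d where "d = card B' - card (R p)"
  have d: "card B' = card (R p) + d" using card_mono[OF fin_B' R_B'] by (simp add: d_def)
  have pV: "p \<in> V" "p \<in> B" "p \<notin> A" using p B'_V by (auto simp: B'_def)
  \<comment> \<open>The only vertex of \<open>A\<close> that may send an arc into \<open>A1\<close>
    is one with symbol \<open>M p r\<close> in row \<open>r\<close>, and \<open>A1\<close> excludes
    it. Hence \<open>A1\<close> is independent.\<close>
  define A1 where "A1 = {a \<in> A. M r a \<noteq> M p r \<and> (\<forall>x\<in>A. (x, a) \<in> G \<longrightarrow> M r x = M p r)}"
  define m where "m = card A1"
  have A1_V: "A1 \<subseteq> V" and fin_A1: "finite A1" using A_sub finite_A by (auto simp: A1_def)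
  have I_A1: "A \<inter> B \<subseteq> A1"
  proof
    fix a assume a: "a \<in> A \<inter> B"
    have "M r a = M a r" using loop_conflict a by blast
    moreover have "M a r \<noteq> M p r" using col[of a p r] a pV A_sub by auto
    ultimately show "a \<in> A1" using a A_B_independent by (auto simp: A1_def)
  qed
  have nonadj: "m * (m - 1) + d * (d + 1) \<le> card (nonadjacent G V)"
  proof -
    have "m * (m - 1) = card (nonadjacent G A1)"
      unfolding m_def by (rule independent_nonadjacent[OF A1_V]) (auto simp: A1_def)
    moreover have "d * (d + 1) \<le> card (nonadjacent G B')"
    proof (rule nonadjacent_ge[OF fin_B'])
      fix q assume "q \<in> B'"
      then show "card (reach_in G B' q) + d \<le> card B'" using p_max[of q] d by (simp add: R_def)
    qed (simp add: d)
    moreover have "card (nonadjacent G A1 \<union> nonadjacent G B') = card (nonadjacent G A1) + card (nonadjacent G B')"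
      using fin_A1 fin_B' by (intro card_Un_disjoint finite_nonadjacent) (auto simp: nonadjacent_def A1_def B'_def)
    moreover have "card (nonadjacent G A1 \<union> nonadjacent G B') \<le> card (nonadjacent G V)"
      using nonadjacent_mono[OF A1_V] nonadjacent_mono[OF B'_V] finite_nonadjacent[OF finite_V]
      by (intro card_mono) auto
    ultimately show ?thesis by linarith
  qed
  define K where "K = {k \<in> V - B'. M k p \<notin> D \<or> M k p \<in> (\<lambda>v. M v v) ` (R p - {p} \<union> Wh)}"
  have path: False if us: "us \<noteq> []" "successively (\<lambda>u v. (u, v) \<in> G) us" "distinct us" "set us \<subseteq> A"
    and b: "b \<in> R p" "M r (hd us) \<noteq> M b r" "M (last us) p = M b b" for us b
  proof -
    have "(p, b) \<in> (G \<inter> B' \<times> B')\<^sup>*" using b(1) by (simp add: R_def)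
    then obtain ys where ys: "ys \<noteq> []" "hd ys = p" "last ys = b" "distinct ys" "set ys \<subseteq> B'"
      "successively (\<lambda>u v. (u, v) \<in> G) ys" using p by (rule distinct_path)
    show False
    proof (rule no_linked_paths[OF us(1,2) _ ys(1,6)])
      show "M (last us) (hd ys) \<in> (\<lambda>v. M v v) ` (set us \<union> set ys) \<or> M (last us) (hd ys) \<notin> D
        \<and> M (last us) (hd ys) \<noteq> M r (hd us) \<and> M (last us) (hd ys) \<noteq> M (last ys) r
        \<and> M (last us) (hd ys) \<notin> set (arc_syms M us) \<union> set (arc_syms M ys)"
        using b(3) ys(1-3) last_in_set[of ys] by auto
    qed (use us ys b R_B' A_sub B_sub hd_in_set[of us] in \<open>auto simp: B'_def\<close>)
  qed
  \<comment> \<open>The walk starting \<open>r\<close>, \<open>a\<close>, \<open>p\<close> must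
    fail, which determines \<open>M r a\<close> in the cases \<open>T\<close> and
    \<open>new\<close>. Starting instead with an in-neighbour \<open>x\<close> of \<open>a\<close>
    in \<open>A\<close> changes the first symbol and removes that clash. The hub case is
    impossible.\<close>
  have K_A: "a \<in> A1 - B" if a: "a \<in> K" "a \<in> A" "M r a \<noteq> M p r" "M a p \<noteq> M p r" for a
  proof -
    have aV: "a \<in> V" "a \<noteq> p" "M r a \<notin> D" using a A_sub pV by (auto simp: A_def)
    have loop: "M r a = M a r" if "a \<in> B" using that a(2) loop_conflict by blast
    have x_ap: "x \<noteq> a" "x \<in> V" "M r x \<noteq> M r a" if "x \<in> A" "(x, a) \<in> G" for x
      using that arc_V row[of r x a] A_sub aV by auto
    consider (T) b where "b \<in> R p" "b \<noteq> p" "M a p = M b b" | (hub) w where "w \<in> Wh" "M a p = M w w"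
      | (new) "M a p \<notin> D" using a(1) by (auto simp: K_def)
    then show ?thesis
    proof cases
      case T
      have b: "b \<in> B'" using T R_B' by auto
      have eq: "M r a = M b r"
      proof (rule ccontr)
        assume "M r a \<noteq> M b r"
        then show False using path[of "[a]" b] a T by auto
      qed
      have "a \<notin> B"
      proof
        assume "a \<in> B"
        then have "M a r = M b r" using loop eq by simp
        then have "a = b" using col[of a b r] aV b B'_V by auto
        then show False using b a by (simp add: B'_def)
      qed
      moreover have "(x, a) \<notin> G" if "x \<in> A" for x
      proof
        assume "(x, a) \<in> G"
        then show False using path[of "[x, a]" b] a T x_ap[of x] that eq by auto
      qed
      ultimately show ?thesis using a by (auto simp: A1_def)
    next
      case hub
      then show ?thesis using no_hub_link[of a p w] a pV aV by auto
    next
      case new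
      have eq: "M a p = M r a"
      proof (rule ccontr)
        assume "M a p \<noteq> M r a"
        then show False using no_linked_paths[of "[a]" "[p]"] a pV aV new by auto
      qed
      have "a \<notin> B"
      proof
        assume "a \<in> B"
        then have "M a p = M a r" using loop eq by simp
        then show False using row[of a p r] aV pV r_notin by auto
      qed
      moreover have "M r x = M p r" if x: "x \<in> A" "(x, a) \<in> G" for x
      proof (rule ccontr)
        assume "M r x \<noteq> M p r"
        then show False
          using no_linked_paths[of "[x, a]" "[p]"] a pV aV new x x_ap[OF x] arc_not_row[OF x(2), of a] eq
          by auto
      qed
      ultimately show ?thesis using a by (auto simp: A1_def)
    qed
  qed
  have fin_K: "finite K" using finite_V by (simp add: K_def)
  \<comment> \<open>In column \<open>p\<close>, a row outside \<open>B'\<close> is in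
    \<open>K\<close> or carries the diagonal symbol of a vertex outside \<open>?U\<close>; the Latin
    property bounds the number of the latter rows.\<close>
  have card_K: "1 + card Wh \<le> card K + d + card (Wh \<inter> B')"
  proof -
    let ?X = "insert r V - B'" and ?U = "R p \<union> Wh"
    let ?bad = "{k \<in> ?X. M k p \<in> (\<lambda>v. M v v) ` (V - ?U)}"
    \<comment> \<open>Row \<open>r\<close> cannot belong to \<open>K\<close>, so it must be shown to
      be bad: diagonal symbols of \<open>W\<close> avoid row \<open>r\<close>, and those of
      \<open>R p\<close> are excluded by a walk that frees its own first symbol.\<close>
    have root: "M r p \<notin> (\<lambda>v. M v v) ` ?U" "M r p \<in> D"
    proof -
      show "M r p \<in> D" using pV by (simp add: A_def)
      show "M r p \<notin> (\<lambda>v. M v v) ` ?U"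
      proof
        assume "M r p \<in> (\<lambda>v. M v v) ` ?U"
        then obtain b where b: "b \<in> ?U" "M r p = M b b" by blast
        then have "b \<in> R p" using diag_W_row[of b p] Wh_W pV by auto
        then have "(p, b) \<in> (G \<inter> B' \<times> B')\<^sup>*" by (simp add: R_def)
        then obtain ys where ys: "ys \<noteq> []" "hd ys = p" "last ys = b" "distinct ys" "set ys \<subseteq> B'"
          "successively (\<lambda>u v. (u, v) \<in> G) ys" using p by (rule distinct_path)
        then show False
          using no_path_from_root[of ys b] b(2) B'_V \<open>b \<in> R p\<close> R_B' last_in_set[of ys] by (auto simp: B'_def)
      qed
    qed
    have "?X \<subseteq> K \<union> ?bad"
    proof
      fix k assume k: "k \<in> ?X"
      show "k \<in> K \<union> ?bad"
      proof (cases "M k p \<in> (\<lambda>v. M v v) ` (V - ?U)")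
        case False
        have "k \<noteq> r" using False root by (auto simp: D_def)
        \<comment> \<open>This accounts for \<open>p\<close> being left out of the freed vertices in
          the definition of \<open>K\<close>.\<close>
        moreover have "M k p \<noteq> M p p" using col[of k p p] k p pV by auto
        ultimately show ?thesis using False k by (auto simp: K_def D_def)
      qed (use k in auto)
    qed
    then have "card ?X \<le> card (K \<union> ?bad)" using fin_K finite_V by (intro card_mono) auto
    also have "\<dots> \<le> card K + card ?bad" by (rule card_Un_le)
    finally have "card ?X \<le> card K + card ?bad" .
    moreover have "card ?bad \<le> card (V - ?U)"
    proof -
      have "inj_on (\<lambda>k. M k p) ?bad" by (rule inj_onI) (use col pV in auto)
      moreover have "(\<lambda>k. M k p) ` ?bad \<subseteq> (\<lambda>v. M v v) ` (V - ?U)" by auto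
      ultimately have "card ?bad \<le> card ((\<lambda>v. M v v) ` (V - ?U))"
        using finite_V by (intro card_inj_on_le[of "\<lambda>k. M k p"]) auto
      also have "\<dots> \<le> card (V - ?U)" using finite_V by (intro card_image_le) auto
      finally show ?thesis .
    qed
    moreover have "card ?X = Suc (card V) - card B'"
      using finite_V r_notin B'_V fin_B' by (subst card_Diff_subset) auto
    moreover have "card (V - ?U) = card V - card ?U"
      using fin_R finite_Wh R_B' B'_V Wh_W W_V by (intro card_Diff_subset) auto
    moreover have "card ?U \<le> card V" "card B' \<le> card V"
      using R_B' B'_V Wh_W W_V finite_V by (auto intro!: card_mono)
    moreover have "card (R p) + card Wh = card ?U + card (R p \<inter> Wh)"
      using card_Un_Int[OF fin_R finite_Wh] .
    moreover have "card (R p \<inter> Wh) \<le> card (Wh \<inter> B')"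
      using R_B' finite_Wh by (intro card_mono) auto
    ultimately show ?thesis using d by linarith
  qed
  \<comment> \<open>Each of the two exceptions in \<open>K_A\<close> concerns at most one vertex;
    the rest of \<open>K \<inter> A\<close> lies in \<open>A1 - B\<close>.\<close>
  have card_KA: "card (K \<inter> A) + card (A \<inter> B) \<le> 2 + m"
  proof -
    let ?E1 = "{a \<in> A. M r a = M p r}" and ?E2 = "{a \<in> V. M a p = M p r}"
    have E1: "card ?E1 \<le> 1"
    proof -
      have "\<forall>x\<in>?E1. \<forall>y\<in>?E1. x = y"
      proof (intro ballI)
        fix x y assume "x \<in> ?E1" "y \<in> ?E1"
        then show "x = y" using row[of r x y] A_sub by auto
      qed
      then show ?thesis using finite_A by (simp add: card_le_Suc0_iff_eq)
    qed
    have E2: "card ?E2 \<le> 1"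
    proof -
      have "\<forall>x\<in>?E2. \<forall>y\<in>?E2. x = y"
      proof (intro ballI)
        fix x y assume "x \<in> ?E2" "y \<in> ?E2"
        then show "x = y" using col[of x y p] pV by auto
      qed
      then show ?thesis using finite_V by (simp add: card_le_Suc0_iff_eq)
    qed
    have "K \<inter> A \<subseteq> ?E1 \<union> ?E2 \<union> (A1 - B)" using K_A by (auto simp: K_def)
    then have "card (K \<inter> A) \<le> card (?E1 \<union> ?E2 \<union> (A1 - B))"
      using finite_A finite_V fin_A1 by (intro card_mono) auto
    also have "\<dots> \<le> card ?E1 + card ?E2 + card (A1 - B)"
      by (meson add_le_mono card_Un_le dual_order.refl le_trans)
    finally have "card (K \<inter> A) \<le> 2 + card (A1 - B)" using E1 E2 by linarith
    moreover have "card (A1 - B) + card (A1 \<inter> B) = m"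
      using card_Un_disjoint[of "A1 - B" "A1 \<inter> B"] fin_A1 unfolding m_def
      by (metis Diff_Int_distrib Diff_disjoint Int_Diff_Un Un_Diff_Int card_Int_Diff add.commute)
    moreover have "A1 \<inter> B = A \<inter> B" using I_A1 by (auto simp: A1_def)
    ultimately show ?thesis by simp
  qed
  have "card (K - A) \<le> card V - card (A \<union> B)"
  proof -
    have "K - A \<subseteq> V - (A \<union> B)" by (auto simp: K_def B'_def)
    then have "card (K - A) \<le> card (V - (A \<union> B))" using finite_V by (intro card_mono) auto
    also have "\<dots> = card V - card (A \<union> B)"
      using finite_A finite_B A_sub B_sub by (intro card_Diff_subset) auto
    finally show ?thesis .
  qed
  moreover have "card K = card (K \<inter> A) + card (K - A)" using fin_K by (rule card_Int_Diff)
  moreover have "card A + card B = card (A \<union> B) + card (A \<inter> B)"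
    using card_Un_Int[OF finite_A finite_B] .
  moreover have "card (A \<union> B) \<le> card V" using A_sub B_sub finite_V by (intro card_mono) auto
  ultimately have "2 * card W + card Wh + 1 \<le> card V + card (Wh \<inter> (B - A)) + d + m"
    using card_K card_KA card_A_ge card_B_ge unfolding B'_def by linarith
  moreover have "card (A \<inter> B) \<le> m" unfolding m_def using I_A1 fin_A1 by (rule card_mono[rotated])
  ultimately show ?thesis using that nonadj by blast
qed

end

section \<open>Numerical contradiction\<close>

text \<open>By Cauchy--Schwarz the three losses \<open>w\<close>, \<open>d\<close>, \<open>m\<close>, whose squares are bounded by the
  slack between \<open>lower\<close> and \<open>upper\<close>, are too small for \<open>key\<close>.\<close>

lemma no_small_excess:
  fixes n l w d m e h :: real
  assumes "0 \<le> l" "l \<le> n - 6"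
    and lower: "343 / 2000 * n\<^sup>2 - n + 2 + (m * (m - 1) + d * (d + 1)) \<le> e"
    and upper: "e \<le> h * (h - 1) - w * (w - 1) + 2 * l"
    and key: "3 * h + 2 * l + 2 - w - d - m \<le> n" and pos: "0 \<le> 3 * h + 2 * l + 3 / 2 - n"
  shows False
proof -
  \<comment> \<open>The shifts by 1/2 complete the squares of the three losses; together they turn
    the 2 of \<open>key\<close> into 3/2.\<close>
  have "(3 * h + 2 * l + 3 / 2 - n)\<^sup>2 \<le> ((w - 1/2) + (d + 1/2) + (m - 1/2))\<^sup>2"
    using pos key by (intro power_mono) auto
  also have "\<dots> \<le> 3 * ((w - 1/2)\<^sup>2 + (d + 1/2)\<^sup>2 + (m - 1/2)\<^sup>2)"
  proof -
    have "0 \<le> ((w - 1/2) - (d + 1/2))\<^sup>2 + ((w - 1/2) - (m - 1/2))\<^sup>2 + ((d + 1/2) - (m - 1/2))\<^sup>2" by simp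
    then show ?thesis by (simp add: power2_eq_square algebra_simps)
  qed
  also have "\<dots> \<le> 3 * (h * (h - 1) + 2 * l - 343 / 2000 * n\<^sup>2 + n - 5 / 4)"
    using lower upper by (simp add: power2_eq_square algebra_simps)
  \<comment> \<open>The coefficient 29/2000 is \<open>3 * 343 / 2000 - 1 / 2\<close>; its positivity
    is what the symbol density provides.\<close>
  finally have "6 * (h - (n - 2 - 2 * l) / 2)\<^sup>2 + 29 / 2000 * n\<^sup>2 + 2 * l * (n - 6 - l) \<le> 0"
    by (simp add: power2_eq_square field_simps)
  moreover have "0 \<le> 6 * (h - (n - 2 - 2 * l) / 2)\<^sup>2" "0 \<le> 2 * l * (n - 6 - l)" using assms(1,2) by auto
  moreover have "0 < 29 / 2000 * n\<^sup>2" using assms(1,2) by (simp add: zero_less_power2)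
  ultimately show False by linarith
qed


lemma nat_mult_pred_nonneg: "0 \<le> real k * (real k - 1)"
  by (cases k) auto

lemma quadratic_pos: "1 / 2 < 343 / 2000 * x\<^sup>2 - x + (2::real)"
proof -
  have "343 / 2000 * x\<^sup>2 - x + 2 = 343 / 2000 * (x - 1000 / 343)\<^sup>2 + 186 / 343"
    by (simp add: power2_eq_square field_simps)
  moreover have "0 \<le> (x - 1000 / 343)\<^sup>2" by simp
  ultimately show ?thesis by linarith
qed

text \<open>Supplies the side conditions of \<open>no_small_excess\<close>. In the application
  \<open>n\<close> is the order, \<open>h\<close> and \<open>l\<close> count the hubs and the other
  vertices of \<open>W\<close>, \<open>w\<close> counts the hubs in \<open>B - A\<close>, and
  \<open>e\<close> is \<open>card H\<close>.\<close>

lemma parameters_contradiction: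
  fixes n h l w d m :: nat and e :: real
  assumes h: "1 \<le> h" and n: "h + l + 1 \<le> n"
    and lower: "343 / 2000 * (real n)\<^sup>2 - n + 2 + (real m * (real m - 1) + real d * (real d + 1)) \<le> e"
    and upper: "e \<le> real h * (real h - 1) - real w * (real w - 1) + 2 * real l"
    and key: "2 * (h + l) + h + 2 \<le> n + w + d + m"
    and overlap: "2 * (h + l) + 3 \<le> n + m"
  shows False
proof -
  let ?q = "343 / 2000 * (real n)\<^sup>2 - real n + 2"
  have q: "1 / 2 < ?q" by (rule quadratic_pos)
  have cap: "?q + real m * (real m - 1) \<le> real h * (real h - 1) + 2 * real l"
    using lower upper nat_mult_pred_nonneg[of w] by (smt (verit) of_nat_0_le_iff mult_nonneg_nonneg)
  \<comment> \<open>Otherwise \<open>h\<close> is at most a third of \<open>n\<close>, and the upper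
    bound in \<open>cap\<close> falls below the quadratic lower bound.\<close>
  have pos: "n \<le> 3 * h + 2 * l + 1"
  proof (rule ccontr)
    assume "\<not> n \<le> 3 * h + 2 * l + 1"
    then have "real (3 * h + 2 * l + 2) \<le> real n" by linarith
    then have hl: "3 * real h + 2 * real l + 2 \<le> real n" by simp
    define y where "y = (real n - 2) / 3"
    have y: "1 \<le> real h" "real h \<le> y" "real n = 3 * y + 2" using h hl by (simp_all add: y_def field_simps)
    have q_le: "?q \<le> real h * (real h - 4) + 3 * y"
      using cap hl y(3) nat_mult_pred_nonneg[of m] by (simp add: algebra_simps)
    \<comment> \<open>Between 1 and \<open>y\<close> the convex quadratic lies below its chord,
      whose maximum is at an end determined by the sign of \<open>y - 3\<close>.\<close>
    have "(real h - 1) * (real h - y) \<le> 0" using y by (intro mult_nonneg_nonpos) auto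
    then have conv: "real h * (real h - 4) \<le> real h * (y - 3) - y" by (simp add: algebra_simps)
    show False
    proof (cases "y \<le> 3")
      case True
      then have "real h * (y - 3) \<le> 1 * (y - 3)" using y(1) by (intro mult_right_mono_neg) auto
      then have "?q \<le> 3 * y - 3" using conv q_le by (simp add: algebra_simps)
      moreover have "?q - (3 * y - 3) = 3087 / 2000 * (y - 5 / 4)\<^sup>2 - 333 / 4000 * y + 40777 / 32000"
        unfolding y(3) by (simp add: power2_eq_square field_simps)
      moreover have "0 \<le> (y - 5 / 4)\<^sup>2" by simp
      ultimately show False using True by linarith
    next
      case False
      then have "real h * (y - 3) \<le> y * (y - 3)" using y(2) by (intro mult_right_mono) auto
      then have "?q \<le> y * (y - 3) + 2 * y" using conv q_le by (simp add: algebra_simps)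
      moreover have "?q - (y * (y - 3) + 2 * y) = 1087 / 2000 * y\<^sup>2 + 29 / 500 * y + 343 / 500"
        unfolding y(3) by (simp add: power2_eq_square field_simps)
      moreover have "0 \<le> y\<^sup>2" by simp
      ultimately show False using False by linarith
    qed
  qed
  \<comment> \<open>Otherwise \<open>overlap\<close> makes \<open>m\<close> at least
    \<open>l + 2 * h - 2\<close>, too large for \<open>cap\<close>; for \<open>h = 1\<close> a few
    small cases remain.\<close>
  have l_le: "l + 6 \<le> n"
  proof (rule ccontr)
    assume "\<not> l + 6 \<le> n"
    then have n_le: "n \<le> l + 5" by simp
    then have m_ge: "l + 2 * h \<le> m + 2" using overlap by presburger
    show False
    proof (cases "h = 1")
      case False
      then obtain k where k: "h = k + 2" using h le_Suc_ex[of 2 h] by (auto simp: add.commute)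
      have "real l + 2 * real k + 2 \<le> real m" using m_ge k by linarith
      then have "(real l + 2 * real k + 2) * (real l + 2 * real k + 1) \<le> real m * (real m - 1)"
        by (intro mult_mono) auto
      then have "(real l + 2 * real k + 2) * (real l + 2 * real k + 1) < real h * (real h - 1) + 2 * real l"
        using cap q by linarith
      then have "(real l)\<^sup>2 + real l + 4 * (real l * real k) + 3 * (real k)\<^sup>2 + 3 * real k < 0"
        unfolding k by (simp add: power2_eq_square algebra_simps)
      then show False by (smt (verit) of_nat_0_le_iff mult_nonneg_nonneg zero_le_power2)
    next
      case True
      have cap1: "?q + real m * (real m - 1) \<le> 2 * real l" using cap True by simp
      have mm: "real j * (real j - 1) \<le> real m * (real m - 1)" if "j \<le> m" "1 \<le> j" for j
        using that by (intro mult_mono) auto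
      have "l \<le> m" using m_ge True by simp
      have "1 \<le> l" using cap1 q nat_mult_pred_nonneg[of m] by (cases l) auto
      then have "real l * (real l - 1) < 2 * real l" using mm[OF \<open>l \<le> m\<close>] cap1 q by linarith
      then have "l < 3" using \<open>1 \<le> l\<close> by simp
      then consider "l = 1" "n \<le> 5" | "l = 1" "n = 6" | "l = 2" "n \<le> 6" | "l = 2" "n = 7"
        using \<open>1 \<le> l\<close> n_le by linarith
      then show False
      proof cases
        case 1
        then have "2 \<le> m" using overlap True by simp
        then show False using mm[of 2] cap1 q 1 by simp
      next
        case 2
        then show False using cap1 nat_mult_pred_nonneg[of m] by simp
      next
        case 3
        then have "3 \<le> m" using overlap True by simp
        then show False using mm[of 3] cap1 q 3 by simp
      next
        case 4
        then have "2 \<le> m" using overlap True by simp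
        then show False using mm[of 2] cap1 4 by simp
      qed
    qed
  qed
  show False
  proof (rule no_small_excess[of "real l" "real n" "real m" "real d" e "real h" "real w"])
    show "3 * real h + 2 * real l + 2 - real w - real d - real m \<le> real n"
    proof -
      have "3 * h + 2 * l + 2 \<le> n + w + d + m" using key by presburger
      then have "real (3 * h + 2 * l + 2) \<le> real (n + w + d + m)" by (rule of_nat_mono)
      then show ?thesis by simp
    qed
    show "0 \<le> 3 * real h + 2 * real l + 3 / 2 - real n" using pos by linarith
    show "real l \<le> real n - 6" using l_le by linarith
  qed (use lower upper in auto)
qed

text \<open>The case without hubs, where \<open>card H\<close> is at most \<open>w = card W\<close>;
  \<open>i\<close> stands for \<open>card (A \<inter> B)\<close>. Eliminating \<open>w\<close>
  leaves \<open>n\<close> at most 5, and then \<open>overlap\<close> is incompatible with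
  \<open>i < w\<close>.\<close>

lemma parameters_contradiction_sparse:
  fixes n w i :: nat and e :: real
  assumes lower: "343 / 2000 * (real n)\<^sup>2 - n + 2 + real i * (real i - 1) \<le> e"
    and upper: "e \<le> w" and w: "2 \<le> w" and overlap: "2 * w + 3 \<le> n + i"
  shows False
proof -
  let ?q = "343 / 2000 * (real n)\<^sup>2 - real n + 2"
  have q: "1 / 2 < ?q" by (rule quadratic_pos)
  have cap: "?q + real i * (real i - 1) \<le> w" using lower upper by linarith
  have n_ge: "n \<le> 5"
  proof (rule ccontr)
    assume "\<not> n \<le> 5"
    then have n6: "6 \<le> real n" by simp
    have "2 * real w \<le> real n + real i - 3" using overlap by linarith
    moreover have "-1 \<le> 2 * (real i * (real i - 1)) - real i"
    proof (cases "i \<le> 1")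
      case True
      then consider "i = 0" | "i = 1" by linarith
      then show ?thesis by cases auto
    next
      case False
      then have "real i * 1 \<le> real i * (real i - 1)" by (intro mult_left_mono) auto
      then show ?thesis by linarith
    qed
    ultimately have "2 * ?q \<le> real n - 2" using cap by (simp add: algebra_simps)
    moreover have "2 * ?q - (real n - 2) = 343 / 1000 * (real n - 6)\<^sup>2 + 279 / 250 * (real n - 6) + 87 / 250"
      by (simp add: power2_eq_square field_simps)
    moreover have "0 \<le> 343 / 1000 * (real n - 6)\<^sup>2 + 279 / 250 * (real n - 6)" using n6 by simp
    ultimately show False by simp
  qed
  then have iw: "2 * w \<le> i + 2" using overlap by simp
  then have "2 \<le> i" using w by simp
  then have "real i * 1 \<le> real i * (real i - 1)" by (intro mult_left_mono) auto
  then have "i < w" using cap q by simp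
  then show False using iw w by simp
qed

text \<open>Here \<open>x\<close> is \<open>card V\<close>, \<open>g\<close> is
  \<open>card G\<close>, \<open>e\<close> is \<open>card H\<close> and \<open>a\<close> counts
  non-adjacent pairs. The coefficient is \<open>2 * 2343 / 4000 - 1\<close>, a rational lower bound
  for \<open>3 - 2 * sqrt 2\<close>.\<close>

lemma hub_lower_bound:
  fixes x g e a :: real
  assumes "2343 / 4000 * (x + 1)\<^sup>2 \<le> 2 * x + g" "e + x * (x - 1) = 2 * g + a"
  shows "343 / 2000 * (x + 1)\<^sup>2 - (x + 1) + 2 + a \<le> e"
proof -
  have "e = 2 * g + a - x * x + x" using assms(2) by (simp add: algebra_simps)
  moreover have "2343 / 4000 * (x * x + 2 * x + 1) \<le> 2 * x + g"
    using assms(1) by (simp add: power2_eq_square algebra_simps)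
  moreover have "(x + 1)\<^sup>2 = x * x + 2 * x + 1" by (simp add: power2_eq_square algebra_simps)
  ultimately show ?thesis by (simp add: field_simps)
qed

section \<open>Bounds on the numbers of arcs and of new symbols in the cross\<close>

context near_transversal
begin

text \<open>By \<open>side\<close> the product in \<open>card_H_le\<close> is at least
  \<open>?w * ?w\<close>. Transposition covers the opposite inequality.\<close>

lemma contradiction_of_side:
  assumes lower: "343 / 2000 * (real (card V + 1))\<^sup>2 - real (card V + 1) + 2 + real (card (nonadjacent G V)) \<le> real (card H)"
    and side: "card (Wh \<inter> (B - A)) \<le> card (Wh \<inter> (A - B))"
  shows False
proof -
  let ?n = "card V + 1" and ?h = "card Wh" and ?l = "card (W - Wh)" and ?w = "card (Wh \<inter> (B - A))"
  have q: "1 / 2 < 343 / 2000 * (real ?n)\<^sup>2 - real ?n + 2" by (rule quadratic_pos)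
  have W: "card W = ?h + ?l" using Wh_W finite_W finite_Wh
    by (metis card_Diff_subset card_mono le_add_diff_inverse)
  have W_le: "card W \<le> card V" using W_V finite_V by (rule card_mono[rotated])
  have I: "card (A \<inter> B) * (card (A \<inter> B) - 1) \<le> card (nonadjacent G V)"
  proof -
    have "A \<inter> B \<subseteq> V" using A_sub by blast
    then have "card (A \<inter> B) * (card (A \<inter> B) - 1) = card (nonadjacent G (A \<inter> B))"
      using A_B_independent by (intro independent_nonadjacent) auto
    also have "\<dots> \<le> card (nonadjacent G V)"
      using nonadjacent_mono[OF \<open>A \<inter> B \<subseteq> V\<close>] finite_nonadjacent[OF finite_V] by (rule card_mono[rotated])
    finally show ?thesis .
  qed
  have pred: "real (k * (k - 1)) = real k * (real k - 1)" for k by (cases k) (auto simp: algebra_simps)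
  have I': "real (card (A \<inter> B)) * (real (card (A \<inter> B)) - 1) \<le> real (card (nonadjacent G V))"
    unfolding pred[symmetric] using I by (rule of_nat_mono)
  show False
  proof (cases "Wh = {}")
    case True
    have "H \<noteq> {}" using lower q by auto
    then obtain u v where uv: "(u, v) \<in> H" by auto
    then have "card {u, v} \<le> card W" using H_W[OF uv] finite_W by (intro card_mono) auto
    then have "2 \<le> card W" using H_V[OF uv] by simp
    moreover have "real (card H) \<le> real (card W)" using card_H_le_no_hub[OF True] by simp
    moreover have "2 * card W + 3 \<le> ?n + card (A \<inter> B)" using card_AB_bound by simp
    moreover have "343 / 2000 * (real ?n)\<^sup>2 - real ?n + 2 + real (card (A \<inter> B)) * (real (card (A \<inter> B)) - 1) \<le> real (card H)"
      using lower I' by linarith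
    ultimately show False using parameters_contradiction_sparse by blast
  next
    case hubs: False
    show False
    proof (cases "B - A = {}")
      case True
      \<comment> \<open>Now \<open>A \<inter> B\<close> is an independent set larger than
        \<open>W\<close>, so there are at least as many non-adjacent pairs as pairs in
        \<open>H\<close>.\<close>
      then have "A \<inter> B = B" by auto
      then have "card W + 1 \<le> card (A \<inter> B)" using card_B_ge by simp
      then have "(card W + 1) * (card W + 1 - 1) \<le> card (A \<inter> B) * (card (A \<inter> B) - 1)"
        by (intro mult_le_mono) auto
      moreover have "card W * (card W - 1) \<le> (card W + 1) * (card W + 1 - 1)" by (intro mult_le_mono) auto
      ultimately have "card H \<le> card (nonadjacent G V)" using card_H_le_W I by linarith
      then show False using lower q by linarith
    next
      case False
      then obtain m d where md: "m * (m - 1) + d * (d + 1) \<le> card (nonadjacent G V)"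
        "card (A \<inter> B) \<le> m" "2 * card W + card Wh + 1 \<le> card V + ?w + d + m"
        by (rule count_from_column)
      show False
      proof (rule parameters_contradiction[of ?h ?l ?n m d "real (card H)" ?w])
        show "1 \<le> ?h" using hubs finite_Wh by (simp add: Suc_le_eq card_gt_0_iff)
        show "?h + ?l + 1 \<le> ?n" using W W_le by simp
        show "343 / 2000 * (real ?n)\<^sup>2 - real ?n + 2 + (real m * (real m - 1) + real d * (real d + 1)) \<le> real (card H)"
        proof -
          have "real (m * (m - 1) + d * (d + 1)) \<le> real (card (nonadjacent G V))" using md(1) by linarith
          then have "real m * (real m - 1) + real d * (real d + 1) \<le> real (card (nonadjacent G V))"
            unfolding of_nat_add pred by (simp only: of_nat_mult of_nat_add of_nat_1)
          then show ?thesis using lower by linarith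
        qed
        show "real (card H) \<le> real ?h * (real ?h - 1) - real ?w * (real ?w - 1) + 2 * real ?l"
        proof -
          have "card H + ?w * ?w \<le> ?h * (?h - 1) + 2 * ?l + ?w"
            using card_H_le mult_le_mono2[OF side, of ?w] by linarith
          then have "real (card H + ?w * ?w) \<le> real (?h * (?h - 1) + 2 * ?l + ?w)" by linarith
          then show ?thesis unfolding of_nat_add pred by (simp add: algebra_simps)
        qed
        show "2 * (?h + ?l) + ?h + 2 \<le> ?n + ?w + d + m" using md(3) W by simp
        show "2 * (?h + ?l) + 3 \<le> ?n + m" using card_AB_bound md(2) W by simp
      qed
    qed
  qed
qed

lemma few_arcs: "2 * real (card V) + real (card G) < (2 - sqrt 2) * (real (card V + 1))\<^sup>2"
proof (rule ccontr)
  assume "\<not> ?thesis"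
  then have G_ge: "(2 - sqrt 2) * (real (card V + 1))\<^sup>2 \<le> 2 * real (card V) + real (card G)" by simp
  have "sqrt 2 \<le> 5657 / 4000" by (rule real_le_lsqrt) (auto simp: power2_eq_square)
  then have "2343 / 4000 * (real (card V + 1))\<^sup>2 \<le> (2 - sqrt 2) * (real (card V + 1))\<^sup>2"
    by (intro mult_right_mono) auto
  then have G_ge: "2343 / 4000 * (real (card V + 1))\<^sup>2 \<le> 2 * real (card V) + real (card G)"
    using G_ge by linarith
  have "real (card V * (card V - 1)) = real (card V) * (real (card V) - 1)"
    by (cases "card V") (auto simp: algebra_simps)
  then have count: "real (card H) + real (card V) * (real (card V) - 1) = 2 * real (card G) + real (card (nonadjacent G V))"
    using card_H by (metis (mono_tags, lifting) of_nat_add of_nat_mult of_nat_numeral)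
  have lower: "343 / 2000 * (real (card V + 1))\<^sup>2 - real (card V + 1) + 2 + real (card (nonadjacent G V)) \<le> real (card H)"
    using hub_lower_bound[OF _ count] G_ge unfolding of_nat_add of_nat_1 by blast
  show False
  proof (cases "card (Wh \<inter> (B - A)) \<le> card (Wh \<inter> (A - B))")
    case True
    then show False using contradiction_of_side lower by blast
  next
    case False
    interpret T: near_transversal V r "\<lambda>i j. M j i" "G\<inverse>" by (rule transposed)
    show False using T.contradiction_of_side lower False by (simp add: transposed_eqs)
  qed
qed

text \<open>For \<open>v\<close> in both \<open>A\<close> and \<open>B\<close> the cells
  \<open>(r, v)\<close> and \<open>(v, r)\<close> agree by \<open>loop_conflict\<close>, so each
  \<open>v\<close> supplies at most one new symbol; \<open>(r, r)\<close> supplies none.\<close>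

lemma card_cross:
  "card (((\<lambda>v. M r v) ` insert r V \<union> (\<lambda>v. M v r) ` insert r V) - D) \<le> card V"
proof -
  have "((\<lambda>v. M r v) ` insert r V \<union> (\<lambda>v. M v r) ` insert r V) - D
      \<subseteq> (\<lambda>v. if v \<in> A then M r v else M v r) ` V" (is "?X \<subseteq> _")
  proof
    fix s assume s: "s \<in> ?X"
    then obtain v where v: "v \<in> insert r V" "s = M r v \<or> s = M v r" "s \<notin> D" by auto
    then have "v \<in> V" using root_old by auto
    moreover have "s = (if v \<in> A then M r v else M v r)"
      using v \<open>v \<in> V\<close> loop_conflict[of v] by (auto simp: A_def B_def)
    ultimately show "s \<in> (\<lambda>v. if v \<in> A then M r v else M v r) ` V" by blast
  qed
  then show ?thesis using finite_V by (meson card_image_le card_mono finite_imageI le_trans)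
qed

end

section \<open>Induction on the order\<close>

text \<open>Arbitrary index sets allow deleting a row and a column without renumbering.\<close>

definition array_symbols :: "'r set \<Rightarrow> 'c set \<Rightarrow> ('r \<Rightarrow> 'c \<Rightarrow> 's) \<Rightarrow> 's set" where
  "array_symbols R C L = (\<lambda>(i, j). L i j) ` (R \<times> C)"

definition latin_on :: "'r set \<Rightarrow> 'c set \<Rightarrow> ('r \<Rightarrow> 'c \<Rightarrow> 's) \<Rightarrow> bool" where
  "latin_on R C L \<longleftrightarrow> (\<forall>i\<in>R. inj_on (L i) C) \<and> (\<forall>j\<in>C. inj_on (\<lambda>i. L i j) R)"

definition rainbow :: "'r set \<Rightarrow> 'c set \<Rightarrow> ('r \<Rightarrow> 'c \<Rightarrow> 's) \<Rightarrow> bool" where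
  "rainbow R C L \<longleftrightarrow> (\<exists>s. bij_betw s R C \<and> inj_on (\<lambda>i. L i (s i)) R)"

lemma finite_array_symbols: "\<lbrakk>finite R; finite C\<rbrakk> \<Longrightarrow> finite (array_symbols R C L)"
  by (simp add: array_symbols_def)

lemma sum_card_swap:
  assumes "finite X" "finite Y"
  shows "(\<Sum>x\<in>X. card {y \<in> Y. P x y}) = (\<Sum>y\<in>Y. card {x \<in> X. P x y})"
proof -
  have "(\<Sum>x\<in>X. card {y \<in> Y. P x y}) = (\<Sum>x\<in>X. \<Sum>y\<in>Y. if P x y then 1 else 0)"
    using assms by (simp flip: sum.inter_filter)
  also have "\<dots> = (\<Sum>y\<in>Y. \<Sum>x\<in>X. if P x y then 1 else 0)" by (rule sum.swap)
  also have "\<dots> = (\<Sum>y\<in>Y. card {x \<in> X. P x y})"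
    using assms by (simp flip: sum.inter_filter)
  finally show ?thesis .
qed

text \<open>Averaging over all crosses: a symbol occurring at \<open>(a, b)\<close> can only vanish from the array
  when row \<open>a\<close> or column \<open>b\<close> is deleted.\<close>

lemma dense_deletion:
  assumes "finite R" "finite C" "card R = Suc n" "card C = Suc n"
  obtains i j where "i \<in> R" "j \<in> C"
    "n\<^sup>2 * card (array_symbols R C L) \<le> (Suc n)\<^sup>2 * card (array_symbols (R - {i}) (C - {j}) L)"
proof -
  let ?S = "array_symbols R C L" and ?S' = "\<lambda>i j. array_symbols (R - {i}) (C - {j}) L"
  let ?E = "\<lambda>x. card {s \<in> ?S. s \<notin> ?S' (fst x) (snd x)}"
  have finS: "finite ?S" using assms finite_array_symbols by blast
  \<comment> \<open>Some cross loses at most the average number of symbols, and each symbol is lost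
    with at most \<open>2 * n + 1\<close> of the \<open>(Suc n)\<^sup>2\<close> crosses.\<close>
  have "\<exists>x \<in> R \<times> C. (Suc n)\<^sup>2 * ?E x \<le> card ?S * (2 * n + 1)"
  proof (rule ccontr)
    assume "\<not> ?thesis"
    then have less: "card ?S * (2 * n + 1) < (Suc n)\<^sup>2 * ?E x" if "x \<in> R \<times> C" for x
      using \<open>\<not> _\<close> that by (meson not_le)
    have "R \<times> C \<noteq> {}" "finite (R \<times> C)" using assms by auto
    then have "(\<Sum>x\<in>R \<times> C. card ?S * (2 * n + 1)) < (\<Sum>x\<in>R \<times> C. (Suc n)\<^sup>2 * ?E x)"
      using less by (intro sum_strict_mono) auto
    then have "(Suc n)\<^sup>2 * (card ?S * (2 * n + 1)) < (Suc n)\<^sup>2 * (\<Sum>x\<in>R \<times> C. ?E x)"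
      using assms by (simp add: card_cartesian_product power2_eq_square sum_distrib_left)
    then have "card ?S * (2 * n + 1) < (\<Sum>x\<in>R \<times> C. ?E x)" by simp
    also have "\<dots> = (\<Sum>s\<in>?S. card {x \<in> R \<times> C. s \<notin> ?S' (fst x) (snd x)})"
      by (rule sum_card_swap) (use assms finS in auto)
    also have "\<dots> \<le> (\<Sum>s\<in>?S. 2 * n + 1)"
    proof (rule sum_mono)
      fix s assume "s \<in> ?S"
      then obtain a b where ab: "a \<in> R" "b \<in> C" "s = L a b" by (auto simp: array_symbols_def)
      have "{x \<in> R \<times> C. s \<notin> ?S' (fst x) (snd x)} \<subseteq> {a} \<times> C \<union> (R - {a}) \<times> {b}"
        using ab by (auto simp: array_symbols_def)
      then have "card {x \<in> R \<times> C. s \<notin> ?S' (fst x) (snd x)} \<le> card ({a} \<times> C \<union> (R - {a}) \<times> {b})"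
        using assms by (intro card_mono) auto
      also have "\<dots> \<le> card ({a} \<times> C) + card ((R - {a}) \<times> {b})" by (rule card_Un_le)
      also have "\<dots> = 2 * n + 1" using assms ab by (simp add: card_cartesian_product)
      finally show "card {x \<in> R \<times> C. s \<notin> ?S' (fst x) (snd x)} \<le> 2 * n + 1" .
    qed
    finally show False by simp
  qed
  then obtain i j where ij: "i \<in> R" "j \<in> C" and
    le: "(Suc n)\<^sup>2 * card {s \<in> ?S. s \<notin> ?S' i j} \<le> card ?S * (2 * n + 1)" by auto
  have "?S' i j \<subseteq> ?S" by (auto simp: array_symbols_def)
  then have "finite (?S' i j)" using finS finite_subset by blast
  then have "card ?S \<le> card (?S' i j \<union> {s \<in> ?S. s \<notin> ?S' i j})"
    using finS by (intro card_mono) auto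
  also have "\<dots> \<le> card (?S' i j) + card {s \<in> ?S. s \<notin> ?S' i j}" by (rule card_Un_le)
  finally have "card ?S \<le> card (?S' i j) + card {s \<in> ?S. s \<notin> ?S' i j}" .
  then have "(Suc n)\<^sup>2 * card ?S \<le> (Suc n)\<^sup>2 * (card (?S' i j) + card {s \<in> ?S. s \<notin> ?S' i j})"
    by (rule mult_le_mono2)
  also have "\<dots> \<le> (Suc n)\<^sup>2 * card (?S' i j) + card ?S * (2 * n + 1)"
    using le by (simp only: distrib_left add_le_cancel_left)
  finally have "(Suc n)\<^sup>2 * card ?S \<le> (Suc n)\<^sup>2 * card (?S' i j) + card ?S * (2 * n + 1)" .
  then have "n\<^sup>2 * card ?S \<le> (Suc n)\<^sup>2 * card (?S' i j)"
    by (simp add: power2_eq_square algebra_simps)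
  then show ?thesis using that ij by blast
qed

text \<open>The partial transversal is chosen to maximise \<open>f\<close>, the number of cells of
  the cross other than \<open>(r, c)\<close> whose symbols it does not use. Relabelling columns by
  \<open>s\<close> makes it the diagonal, and \<open>few_arcs\<close> then contradicts
  \<open>many\<close>.\<close>

lemma rainbow_step:
  assumes "finite R" "finite C" and latin: "latin_on R C L"
    and r: "r \<in> R" "c \<in> C" and sub: "rainbow (R - {r}) (C - {c}) L"
    and many: "(2 - sqrt 2) * (real (card R))\<^sup>2 \<le> real (card (array_symbols R C L))"
  shows "rainbow R C L"
proof (rule ccontr)
  assume no_rainbow: "\<not> rainbow R C L"
  define V where "V = R - {r}"
  have R: "R = insert r V" and rV: "r \<notin> V" and finV: "finite V" using r assms(1) by (auto simp: V_def)
  define old where "old s = (\<lambda>v. L v (s v)) ` V" for s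
  define P where "P s \<longleftrightarrow> bij_betw s R C \<and> s r = c \<and> inj_on (\<lambda>v. L v (s v)) V" for s
  define f where "f s = card {v \<in> V. L r (s v) \<notin> old s} + card {v \<in> V. L v c \<notin> old s}" for s
  obtain s0 where s0: "bij_betw s0 V (C - {c})" "inj_on (\<lambda>i. L i (s0 i)) V"
    using sub by (auto simp: rainbow_def V_def)
  have "P (s0(r := c))"
    unfolding P_def
  proof (intro conjI)
    have "bij_betw (s0(r := c)) V (C - {c})"
      using s0(1) rV by (subst bij_betw_cong[of _ _ s0]) auto
    then have "bij_betw (s0(r := c)) (V \<union> {r}) ((C - {c}) \<union> {c})"
      by (intro bij_betw_combine) (auto simp: bij_betw_def)
    then show "bij_betw (s0(r := c)) R C" using r by (simp add: R insert_absorb)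
    show "inj_on (\<lambda>v. L v ((s0(r := c)) v)) V"
      using s0(2) rV by (subst inj_on_cong[of _ _ "\<lambda>i. L i (s0 i)"]) auto
  qed simp
  moreover have "\<forall>s. P s \<longrightarrow> f s < 2 * card V + 1"
  proof (intro allI impI)
    fix s
    have "card {v \<in> V. L r (s v) \<notin> old s} \<le> card V" "card {v \<in> V. L v c \<notin> old s} \<le> card V"
      using finV by (auto intro!: card_mono)
    then show "f s < 2 * card V + 1" by (simp add: f_def)
  qed
  ultimately obtain s where s: "P s" and s_max: "\<And>s'. P s' \<Longrightarrow> f s' \<le> f s"
    using ex_has_greatest_nat[of P _ f] by blast
  have bij: "bij_betw s R C" and sr: "s r = c" and s_inj: "inj_on (\<lambda>v. L v (s v)) V"
    using s by (auto simp: P_def)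
  have sC: "s v \<in> C" if "v \<in> R" for v using bij_betwE[OF bij] that by blast
  define M where "M i j = L i (s j)" for i j
  define T where "T = (\<lambda>v. M v v) ` V"
  have old_s: "old s = T" by (simp add: old_def T_def M_def)
  have row: "j = j'" if "i \<in> R" "j \<in> R" "j' \<in> R" "M i j = M i j'" for i j j'
  proof -
    have "s j = s j'" using latin that sC unfolding latin_on_def M_def by (meson inj_onD)
    then show ?thesis using bij that by (meson bij_betw_def inj_onD)
  qed
  have col: "i = i'" if "i \<in> R" "i' \<in> R" "j \<in> R" "M i j = M i' j" for i i' j
    using latin that sC unfolding latin_on_def M_def by (meson inj_onD)
  have diag: "inj_on (\<lambda>v. M v v) V" using s_inj by (simp add: M_def)
  have no_perm: "\<not> inj_on (\<lambda>i. M i (p i)) R" if "p permutes R" for p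
  proof
    assume "inj_on (\<lambda>i. M i (p i)) R"
    moreover have "bij_betw (s \<circ> p) R C" using bij that by (meson bij_betw_trans permutes_imp_bij)
    ultimately have "rainbow R C L" by (auto simp: rainbow_def M_def intro!: exI[of _ "s \<circ> p"])
    then show False using no_rainbow by simp
  qed
  define Q where "Q = {(k, l) \<in> V \<times> V. M k l \<notin> T \<and> (\<forall>v\<in>R. M k l \<noteq> M r v \<and> M k l \<noteq> M v r)}"
  \<comment> \<open>One cell of \<open>Q\<close> for each symbol: this gives \<open>arc_inj\<close>
    and loses no symbol.\<close>
  obtain G where G: "G \<subseteq> Q" "inj_on (\<lambda>(k, l). M k l) G"
    and G_im: "(\<lambda>(k, l). M k l) ` Q = (\<lambda>(k, l). M k l) ` G"
    using subset_image_inj[of "(\<lambda>(k, l). M k l) ` Q" "\<lambda>(k, l). M k l" Q] by auto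
  have G_inj: "k = k' \<and> l = l'" if "(k, l) \<in> G" "(k', l') \<in> G" "M k l = M k' l'" for k l k' l'
    using inj_onD[OF G(2), of "(k, l)" "(k', l')"] that by auto
  \<comment> \<open>Exchanging \<open>(k, k)\<close> and \<open>(l, l)\<close> for
    \<open>(k, l)\<close> and \<open>(l, k)\<close> frees \<open>M k k\<close>. If the cross
    contained this symbol, \<open>f\<close> could be increased or, when it stands at
    \<open>(r, r)\<close>, a transversal would arise.\<close>
  have swap: "M k k \<noteq> M r v \<and> M k k \<noteq> M v r" if kl: "(k, l) \<in> G" "(l, k) \<in> G" and v: "v \<in> R" for k l v
  proof (rule ccontr)
    assume "\<not> ?thesis"
    then have Mk: "M k k = M r v \<or> M k k = M v r" by auto
    have Q: "(k, l) \<in> Q" "(l, k) \<in> Q" using kl G(1) by auto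
    then have V: "k \<in> V" "l \<in> V" and new: "M k l \<notin> T" "M l k \<notin> T"
      and cross: "\<And>v. v \<in> R \<Longrightarrow> M k l \<noteq> M r v \<and> M k l \<noteq> M v r"
        "\<And>v. v \<in> R \<Longrightarrow> M l k \<noteq> M r v \<and> M l k \<noteq> M v r"
      by (auto simp: Q_def)
    have "k \<noteq> l" using new(1) V by (auto simp: T_def)
    then have neq: "M k l \<noteq> M l k" using G_inj[OF kl] by auto
    let ?t = "transpose k l"
    have t: "?t permutes R" "?t permutes V" using V by (auto simp: R intro!: permutes_swap_id)
    have t_r: "?t r = r" using V rV by (auto simp: transpose_def)
    have t_syms: "M k (?t k) = M k l" "M l (?t l) = M l k" "\<And>i. i \<notin> {k, l} \<Longrightarrow> M i (?t i) = M i i"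
      by (auto simp: transpose_def)
    have inj_t: "inj_on (\<lambda>i. M i (?t i)) V"
    proof (rule inj_onI)
      fix x y assume xy: "x \<in> V" "y \<in> V" "M x (?t x) = M y (?t y)"
      have old_new: "M x (?t x) \<in> T \<longleftrightarrow> x \<notin> {k, l}" if "x \<in> V" for x
        using that new t_syms by (cases "x \<in> {k, l}") (auto simp: T_def)
      show "x = y"
      proof (cases "x \<in> {k, l}")
        case True
        then have "y \<in> {k, l}" using old_new xy by metis
        then show ?thesis using True xy(3) neq \<open>k \<noteq> l\<close> by auto
      next
        case False
        then have "y \<notin> {k, l}" using old_new xy by metis
        then have "M x x = M y y" using xy(3) False t_syms(3) by metis
        then show ?thesis using xy inj_onD[OF diag] by blast
      qed
    qed
    define s' where "s' = s \<circ> ?t"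
    have P': "P s'"
      unfolding P_def s'_def using bij_betw_trans[OF permutes_imp_bij[OF t(1)] bij] inj_t sr t_r
      by (auto simp: M_def)
    have old': "old s' = (\<lambda>i. M i (?t i)) ` V" by (simp add: old_def s'_def M_def)
    have Mkk: "M k k \<notin> old s'"
    proof
      assume "M k k \<in> old s'"
      then obtain i where i: "i \<in> V" "M k k = M i (?t i)" unfolding old' by auto
      have "M k k \<in> T" using V by (simp add: T_def)
      then have "i \<notin> {k, l}" using i new t_syms by auto
      then have "M k k = M i i" using i t_syms(3) by metis
      then show False using inj_onD[OF diag, of k i] i V \<open>i \<notin> {k, l}\<close> by auto
    qed
    \<comment> \<open>The exchange brings in only two symbols, both absent from the cross, so no
      cell counted by \<open>f\<close> is lost.\<close>
    have stay_new: "x \<notin> old s'" if "x \<notin> T" "x \<noteq> M k l" "x \<noteq> M l k" for x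
    proof
      assume "x \<in> old s'"
      then obtain i where "i \<in> V" "x = M i (?t i)" unfolding old' by auto
      then show False using that t_syms by (cases "i \<in> {k, l}") (auto simp: T_def)
    qed
    show False
    proof (cases "v = r")
      case True
      then have "M r r = M k k" using Mk by auto
      then have "M r (?t r) \<notin> (\<lambda>i. M i (?t i)) ` V" using Mkk t_r old' by metis
      then have "inj_on (\<lambda>i. M i (?t i)) R" using inj_t rV by (simp add: R)
      then show False using no_perm[OF t(1)] by simp
    next
      case False
      then have "v \<in> V" using v by (simp add: R)
      let ?A = "{v \<in> V. M r v \<notin> T}" and ?B = "{v \<in> V. M v r \<notin> T}"
      let ?A' = "{v \<in> V. M r v \<notin> old s'}" and ?B' = "{v \<in> V. M v r \<notin> old s'}"
      have "M r u \<notin> old s'" if "u \<in> V" "M r u \<notin> T" for u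
        using stay_new[OF that(2)] cross(1)[of u] cross(2)[of u] that(1) unfolding R by auto
      moreover have "M u r \<notin> old s'" if "u \<in> V" "M u r \<notin> T" for u
        using stay_new[OF that(2)] cross(1)[of u] cross(2)[of u] that(1) unfolding R by auto
      ultimately have sub: "?A \<subseteq> ?A'" "?B \<subseteq> ?B'" by auto
      have kT: "M k k \<in> T" using V by (simp add: T_def)
      have fin: "finite ?A'" "finite ?B'" using finV by auto
      have "card ?A + card ?B < card ?A' + card ?B'"
        using Mk
      proof
        assume e: "M k k = M r v"
        then have "v \<in> ?A' - ?A" using Mkk kT \<open>v \<in> V\<close> by simp
        then have "card ?A < card ?A'" using sub fin by (intro psubset_card_mono) auto
        moreover have "card ?B \<le> card ?B'" using sub fin by (intro card_mono) auto
        ultimately show ?thesis by linarith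
      next
        assume e: "M k k = M v r"
        then have "v \<in> ?B' - ?B" using Mkk kT \<open>v \<in> V\<close> by simp
        then have "card ?B < card ?B'" using sub fin by (intro psubset_card_mono) auto
        moreover have "card ?A \<le> card ?A'" using sub fin by (intro card_mono) auto
        ultimately show ?thesis by linarith
      qed
      moreover have "f s = card ?A + card ?B" by (simp add: f_def old_s M_def sr)
      moreover have "f s' = card ?A' + card ?B'"
      proof -
        \<comment> \<open>The indices of \<open>s'\<close> are permuted by \<open>?t\<close>, so row
          \<open>r\<close> has the same cells in another order.\<close>
        have "{v \<in> V. L r (s' v) \<notin> old s'} = ?t ` ?A'"
        proof (intro equalityI subsetI)
          fix x assume "x \<in> {v \<in> V. L r (s' v) \<notin> old s'}"
          then have "?t x \<in> ?A'" using permutes_in_image[OF t(2)] by (auto simp: M_def s'_def)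
          then show "x \<in> ?t ` ?A'" by (metis (no_types, lifting) image_eqI transpose_involutory)
        next
          fix x assume "x \<in> ?t ` ?A'"
          then show "x \<in> {v \<in> V. L r (s' v) \<notin> old s'}"
            using permutes_in_image[OF t(2)] by (auto simp: M_def s'_def)
        qed
        then have "card {v \<in> V. L r (s' v) \<notin> old s'} = card ?A'"
          using card_image[OF inj_on_subset[OF permutes_inj[OF t(2)]], of ?A'] by simp
        then show ?thesis by (simp add: f_def M_def sr)
      qed
      ultimately show False using s_max[OF P'] by linarith
    qed
  qed
  interpret near_transversal V r M G
  proof
    show "inj_on (\<lambda>v. M v v) V" by (rule diag)
    show "G \<subseteq> V \<times> V" using G(1) by (auto simp: Q_def)
    fix k l v assume "(k, l) \<in> G"
    then have kl: "(k, l) \<in> Q" using G(1) by auto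
    show "M k l \<noteq> M v v" if "v \<in> V" using kl that by (auto simp: Q_def T_def)
    show "M k l \<noteq> M r v" "M k l \<noteq> M v r" if "v \<in> insert r V" using kl that by (auto simp: Q_def R)
  next
    fix k l v assume "(k, l) \<in> G" "(l, k) \<in> G" "v \<in> insert r V"
    then show "M k k \<noteq> M r v" "M k k \<noteq> M v r" using swap by (auto simp: R)
  next
    fix p assume "p permutes insert r V"
    then show "\<not> inj_on (\<lambda>i. M i (p i)) (insert r V)" using no_perm by (simp add: R)
  next
    fix i j j' assume "i \<in> insert r V" "j \<in> insert r V" "j' \<in> insert r V" "M i j = M i j'"
    then show "j = j'" unfolding R[symmetric] by (rule row)
  next
    fix i i' j assume "i \<in> insert r V" "i' \<in> insert r V" "j \<in> insert r V" "M i j = M i' j"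
    then show "i = i'" unfolding R[symmetric] by (rule col)
  next
    fix k l k' l' assume "(k, l) \<in> G" "(k', l') \<in> G" "M k l = M k' l'"
    then show "k = k' \<and> l = l'" by (rule G_inj)
  qed (use finV rV in auto)
  let ?X = "(\<lambda>v. M r v) ` insert r V \<union> (\<lambda>v. M v r) ` insert r V"
  have D_T: "D = T" by (simp add: D_def T_def)
  have "array_symbols R C L \<subseteq> T \<union> (?X - D) \<union> (\<lambda>(k, l). M k l) ` G"
  proof
    fix x assume "x \<in> array_symbols R C L"
    then obtain i j' where ij': "i \<in> R" "j' \<in> C" "x = L i j'" by (auto simp: array_symbols_def)
    then obtain j where j: "j \<in> R" "j' = s j" using bij by (auto simp: bij_betw_def)
    then have x: "x = M i j" using ij' by (simp add: M_def)
    show "x \<in> T \<union> (?X - D) \<union> (\<lambda>(k, l). M k l) ` G"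
    proof (cases "x \<in> T \<or> x \<in> ?X")
      case True
      then show ?thesis using D_T by blast
    next
      case False
      then have "i \<noteq> r" "j \<noteq> r" using x ij'(1) j(1) by (auto simp: R)
      then have "(i, j) \<in> Q" using False x ij'(1) j(1) by (auto simp: Q_def R)
      then have "x \<in> (\<lambda>(k, l). M k l) ` Q" using x by (auto intro!: image_eqI[of _ _ "(i, j)"])
      then show ?thesis using G_im by simp
    qed
  qed
  then have "card (array_symbols R C L) \<le> card (T \<union> (?X - D) \<union> (\<lambda>(k, l). M k l) ` G)"
    using finV finite_G by (intro card_mono) (auto simp: T_def)
  also have "\<dots> \<le> card T + card (?X - D) + card ((\<lambda>(k, l). M k l) ` G)"
    by (meson add_le_mono card_Un_le dual_order.refl le_trans)
  also have "\<dots> \<le> card V + card V + card G"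
    using card_cross card_image_le[OF finite_G] card_image_le[OF finV] unfolding T_def
    by (intro add_mono) auto
  finally have "real (card (array_symbols R C L)) \<le> 2 * real (card V) + real (card G)" by linarith
  moreover have "card R = card V + 1" using rV finV by (simp add: R)
  ultimately show False using few_arcs many by simp
qed


theorem rainbow_if_many_symbols:
  assumes "finite R" "finite C" "card R = n" "card C = n" "latin_on R C L"
    and "(2 - sqrt 2) * (real n)\<^sup>2 \<le> real (card (array_symbols R C L))"
  shows "rainbow R C L"
  using assms
proof (induction n arbitrary: R C)
  case 0
  then show ?case by (simp add: rainbow_def bij_betw_def)
next
  case (Suc n)
  obtain i j where ij: "i \<in> R" "j \<in> C" and
    le: "n\<^sup>2 * card (array_symbols R C L) \<le> (Suc n)\<^sup>2 * card (array_symbols (R - {i}) (C - {j}) L)"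
    using dense_deletion[OF Suc.prems(1-4)] by blast
  have "rainbow (R - {i}) (C - {j}) L"
  proof (rule Suc.IH)
    show "latin_on (R - {i}) (C - {j}) L"
      using Suc.prems(5) unfolding latin_on_def by (meson Diff_subset inj_on_subset DiffD1)
    \<comment> \<open>Deletion does not lower the number of symbols relative to the square of the
      order; the cross-multiplied form also covers \<open>n = 0\<close>.\<close>
    have "(real (Suc n))\<^sup>2 * ((2 - sqrt 2) * (real n)\<^sup>2) = (real n)\<^sup>2 * ((2 - sqrt 2) * (real (Suc n))\<^sup>2)"
      by (simp only: ac_simps)
    also have "\<dots> \<le> (real n)\<^sup>2 * real (card (array_symbols R C L))"
      using Suc.prems(6) by (rule mult_left_mono) simp
    also have "\<dots> \<le> (real (Suc n))\<^sup>2 * real (card (array_symbols (R - {i}) (C - {j}) L))"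
      using of_nat_mono[OF le, where 'a = real] by (simp only: of_nat_mult of_nat_power)
    finally show "(2 - sqrt 2) * (real n)\<^sup>2 \<le> real (card (array_symbols (R - {i}) (C - {j}) L))"
      by (rule mult_left_le_imp_le) simp
  qed (use Suc.prems ij in auto)
  then show ?case
    using rainbow_step[OF Suc.prems(1,2,5) ij] Suc.prems(3,6) by simp
qed

theorem mainTheorem12:
  fixes n :: nat and L :: "nat \<Rightarrow> nat \<Rightarrow> 'a"
  assumes "latin_array n L"
    and "real (card (symbols n L)) \<ge> (2 - sqrt 2) * (real n)^2"
  shows "has_transversal n L"
proof -
  have "symbols n L = array_symbols {..<n} {..<n} L"
    by (auto simp: symbols_def array_symbols_def)
  moreover have "latin_on {..<n} {..<n} L"
    using assms(1) unfolding latin_array_def latin_on_def inj_on_def by blast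
  ultimately have "rainbow {..<n} {..<n} L"
    using assms(2) by (intro rainbow_if_many_symbols) auto
  then obtain s where s: "bij_betw s {..<n} {..<n}" "inj_on (\<lambda>i. L i (s i)) {..<n}"
    by (auto simp: rainbow_def)
  let ?T = "(\<lambda>i. (i, s i, L i (s i))) ` {..<n}"
  have "card ?T = n" by (simp add: card_image inj_on_def)
  moreover have "?T \<subseteq> entries n L" using s(1) by (auto simp: entries_def bij_betw_def)
  moreover have "inj_on s {..<n}" using s(1) by (simp add: bij_betw_def)
  moreover have "\<forall>(i, j, t)\<in>?T. \<forall>(i', j', t')\<in>?T. (i, j, t) \<noteq> (i', j', t') \<longrightarrow> i \<noteq> i' \<and> j \<noteq> j' \<and> t \<noteq> t'"
  proof -
    have "i = j" if "i < n" "j < n" "s i = s j \<or> L i (s i) = L j (s j)" for i j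
      using that inj_onD[OF s(2), of i j] inj_onD[OF \<open>inj_on s {..<n}\<close>, of i j] by auto
    then show ?thesis by (simp add: Ball_def image_iff) metis
  qed
  ultimately have "transversal n L ?T" unfolding transversal_def by (intro conjI)
  then show ?thesis unfolding has_transversal_def by blast
qed

end
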